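(* There is an absolute constant $C_1>0$ such that for every integer $n\ge1$ and every $\sigma>0$ the estimator $\hat Z$ of the minimizer (constructed in the context) satisfies $$\mathbb E_f|\hat Z-Z(f)|\le C_1\,\tilde R_{z,n}(\sigma;f)\qquad\text{for all } f\in\mathcal F.$$
   Context: $\mathcal F$ is the collection of convex functions $f:[0,1]\to\mathbb R$ with a unique minimizer $Z(f)=\arg\min_{0\le t\le1}f(t)$. Nonparametric regression model: one observes $y_i=f(x_i)+\sigma z_i$, $i=0,1,\dots,n$, with $x_i=i/n$, $z_i$ i.i.d. $N(0,1)$ and $\sigma>0$ known; $\mathbb E_f$ is expectation under $f$ (including auxiliary randomness). Benchmark: $\tilde R_{z,n}(\sigma;f)=\sup_{g\in\mathcal F}\inf_{\hat Z}\max_{h\in\{f,g\}}\mathbb E_h|\hat Z-Z(h)|$, infimum over all estimators based on $y_0,\dots,y_n$. Construction of $\hat Z$. Data splitting: let $z_{1,0},\dots,z_{1,n},z_{2,0},\dots,z_{2,n}$ be i.i.d. $N(0,1)$, independent of the data. For $i=0,\dots,n$ set $y_{l,i}=y_i+\frac{\sqrt2}{2}\sigma z_{1,i}+\frac{\sqrt6}{2}\sigma z_{2,i}$, $y_{s,i}=y_i+\frac{\sqrt2}{2}\sigma z_{1,i}-\frac{\sqrt6}{2}\sigma z_{2,i}$, $y_{e,i}=y_i-\sqrt2\,\sigma z_{1,i}$; set $y_{l,i}=y_{s,i}=y_{e,i}=+\infty$ for $i\notin\{0,\dots,n\}$. Blocks: let $J=\lfloor\log_2(n+1)\rfloor$.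 For $0\le j\le J$ the $i$-th block at level $j$ is $\{x_{(i-1)2^{J-j}},\dots,x_{i2^{J-j}-1}\}$. For $u\in\{l,s,e\}$ let $Y_{j,i,u}=\sum_{k=(i-1)2^{J-j}}^{i2^{J-j}-1}y_{u,k}$, which is $+\infty$ whenever the block is not entirely contained in the sample, i.e. whenever $i\notin\{1,\dots,\lfloor(n+1)/2^{J-j}\rfloor\}$. Localization: $\hat i_0=1$ and for $j=1,\dots,J$, $\hat i_j=\arg\min Y_{j,i,l}$ over $\max\{2\hat i_{j-1}-2,1\}\le i\le\min\{2\hat i_{j-1}+1,\lfloor(n+1)/2^{J-j}\rfloor\}$. Stopping: $T_j=\min\{Y_{j,\hat i_j+6,s}-Y_{j,\hat i_j+5,s},\ Y_{j,\hat i_j-6,s}-Y_{j,\hat i_j-5,s}\}$ (with $+\infty-x=+\infty$ for all $x\le+\infty$), $\tilde\sigma_j^2=6\cdot2^{J-j}\sigma^2$. Let $\check j=\min\{j\in\{0,\dots,J\}:T_j\le2\tilde\sigma_j\}$ if this set is nonempty and $\check j=\infty$ otherwise; $\hat j=\min\{J,\check j\}$. Estimator: if $\check j<\infty$, $$\hat Z=-\frac1{2n}+\frac1n\big(2^{J-\hat j}\,\hat i_{\hat j}-2^{J-\hat j-1}\big);$$ if $\check j=\infty$, $$\hat Z=\frac1n\Big(\arg\min_{\hat i_{\hat j}-2\le i\le\hat i_{\hat j}+2}y_{e,i-1}\Big)-\frac1n.$$ *)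

theory Defs
  imports "HOL-Probability.Probability" "HOL-Library.Extended_Nat"
begin

text \<open>
  Elements of \<open>convex_class\<close> are total functions on the reals, but only their values
  on the unit interval enter any of the definitions below.
\<close>

definition convex_class :: "(real \<Rightarrow> real) set" where
  "convex_class =
     {f. convex_on {0..1} f \<and> (\<exists>!t. is_arg_min f (\<lambda>t. t \<in> {0..1}) t)}"

definition minimizer :: "(real \<Rightarrow> real) \<Rightarrow> real" where
  "minimizer f = arg_min_on f {0..1}"

definition noise :: "nat \<Rightarrow> (nat \<Rightarrow> real) measure" where
  "noise n = (\<Pi>\<^sub>M i\<in>{0..n}. std_normal_distribution)"

definition data_law :: "nat \<Rightarrow> real \<Rightarrow> (real \<Rightarrow> real) \<Rightarrow> (nat \<Rightarrow> real) measure" where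
  "data_law n \<sigma> f =
     distr (noise n) (\<Pi>\<^sub>M i\<in>{0..n}. borel)
       (\<lambda>z. \<lambda>i\<in>{0..n}. f (real i / real n) + \<sigma> * z i)"

definition estimators :: "nat \<Rightarrow> ((nat \<Rightarrow> real) \<Rightarrow> real) set" where
  "estimators n = borel_measurable (\<Pi>\<^sub>M i\<in>{0..n}. borel)"

text \<open>
  Risks are nonnegative Lebesgue integrals with values in \<open>ennreal\<close>: the Bochner integral
  would assign risk 0 to an estimator without a first moment.
\<close>

definition risk :: "nat \<Rightarrow> real \<Rightarrow> (real \<Rightarrow> real) \<Rightarrow> ((nat \<Rightarrow> real) \<Rightarrow> real) \<Rightarrow> ennreal" where
  "risk n \<sigma> h \<delta> = (\<integral>\<^sup>+ y. ennreal \<bar>\<delta> y - minimizer h\<bar> \<partial>data_law n \<sigma> h)"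

definition benchmark :: "nat \<Rightarrow> real \<Rightarrow> (real \<Rightarrow> real) \<Rightarrow> ennreal" where
  "benchmark n \<sigma> f =
     (SUP g\<in>convex_class. INF \<delta>\<in>estimators n. max (risk n \<sigma> f \<delta>) (risk n \<sigma> g \<delta>))"

text \<open>
  Indices of samples and blocks are integers, since the stopping rule and the final step may
  look outside the sample, where the value is \<open>\<infinity>\<close>.
\<close>

definition extend_sample :: "nat \<Rightarrow> (nat \<Rightarrow> real) \<Rightarrow> int \<Rightarrow> ereal" where
  "extend_sample n v i = (if i \<in> {0..int n} then ereal (v (nat i)) else \<infinity>)"

definition sample_l ::
    "nat \<Rightarrow> real \<Rightarrow> (nat \<Rightarrow> real) \<Rightarrow> (nat \<Rightarrow> real) \<Rightarrow> (nat \<Rightarrow> real) \<Rightarrow> int \<Rightarrow> ereal" where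
  "sample_l n \<sigma> y z1 z2 =
     extend_sample n (\<lambda>i. y i + sqrt 2 / 2 * \<sigma> * z1 i + sqrt 6 / 2 * \<sigma> * z2 i)"

definition sample_s ::
    "nat \<Rightarrow> real \<Rightarrow> (nat \<Rightarrow> real) \<Rightarrow> (nat \<Rightarrow> real) \<Rightarrow> (nat \<Rightarrow> real) \<Rightarrow> int \<Rightarrow> ereal" where
  "sample_s n \<sigma> y z1 z2 =
     extend_sample n (\<lambda>i. y i + sqrt 2 / 2 * \<sigma> * z1 i - sqrt 6 / 2 * \<sigma> * z2 i)"

definition sample_e ::
    "nat \<Rightarrow> real \<Rightarrow> (nat \<Rightarrow> real) \<Rightarrow> (nat \<Rightarrow> real) \<Rightarrow> int \<Rightarrow> ereal" where
  "sample_e n \<sigma> y z1 = extend_sample n (\<lambda>i. y i - sqrt 2 * \<sigma> * z1 i)"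

definition max_level :: "nat \<Rightarrow> nat" where
  "max_level n = nat \<lfloor>log 2 (real (n + 1))\<rfloor>"

text \<open>
  A sum in \<open>ereal\<close> with an infinite and no negatively infinite term is \<open>\<infinity>\<close>, so this is
  \<open>\<infinity>\<close> as soon as the block is not contained in the sample.
\<close>

definition block_sum :: "nat \<Rightarrow> (int \<Rightarrow> ereal) \<Rightarrow> nat \<Rightarrow> int \<Rightarrow> ereal" where
  "block_sum n u j i =
     (\<Sum>k\<in>{(i - 1) * 2 ^ (max_level n - j) .. i * 2 ^ (max_level n - j) - 1}. u k)"

text \<open>
  Here and in \<open>Z_hat\<close>, \<open>arg_min_on\<close> breaks ties by a fixed choice; for \<open>\<sigma> > 0\<close> ties
  have probability zero.
\<close>

primrec loc_index :: "nat \<Rightarrow> (int \<Rightarrow> ereal) \<Rightarrow> nat \<Rightarrow> int" where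
  "loc_index n l 0 = 1"
| "loc_index n l (Suc j) =
     arg_min_on (block_sum n l (Suc j))
       {max (2 * loc_index n l j - 2) 1 ..
        min (2 * loc_index n l j + 1) (int ((n + 1) div 2 ^ (max_level n - Suc j)))}"

text \<open>In \<open>ereal\<close>, \<open>\<infinity> - x = \<infinity>\<close> for every \<open>x\<close>, including \<open>x = \<infinity>\<close>.\<close>

definition stop_stat :: "nat \<Rightarrow> (int \<Rightarrow> ereal) \<Rightarrow> (int \<Rightarrow> ereal) \<Rightarrow> nat \<Rightarrow> ereal" where
  "stop_stat n l s j =
     (let i = loc_index n l j in
      min (block_sum n s j (i + 6) - block_sum n s j (i + 5))
          (block_sum n s j (i - 6) - block_sum n s j (i - 5)))"

definition sigma_tilde :: "nat \<Rightarrow> real \<Rightarrow> nat \<Rightarrow> real" where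
  "sigma_tilde n \<sigma> j = sqrt (6 * 2 ^ (max_level n - j) * \<sigma>\<^sup>2)"

text \<open>The infimum of the empty set in \<open>enat\<close> is \<open>\<infinity>\<close>.\<close>

definition check_level :: "nat \<Rightarrow> real \<Rightarrow> (int \<Rightarrow> ereal) \<Rightarrow> (int \<Rightarrow> ereal) \<Rightarrow> enat" where
  "check_level n \<sigma> l s =
     (INF j\<in>{j. j \<le> max_level n \<and> stop_stat n l s j \<le> ereal (2 * sigma_tilde n \<sigma> j)}. enat j)"

definition hat_level :: "nat \<Rightarrow> real \<Rightarrow> (int \<Rightarrow> ereal) \<Rightarrow> (int \<Rightarrow> ereal) \<Rightarrow> nat" where
  "hat_level n \<sigma> l s = the_enat (min (enat (max_level n)) (check_level n \<sigma> l s))"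

text \<open>
  The exponent \<open>J - j - 1\<close> below equals \<open>-1\<close> when the stopping level is \<open>j = J\<close>, hence the
  integer power.
\<close>

definition Z_hat ::
    "nat \<Rightarrow> real \<Rightarrow> (nat \<Rightarrow> real) \<Rightarrow> (nat \<Rightarrow> real) \<Rightarrow> (nat \<Rightarrow> real) \<Rightarrow> real" where
  "Z_hat n \<sigma> y z1 z2 =
     (let l = sample_l n \<sigma> y z1 z2;
          s = sample_s n \<sigma> y z1 z2;
          e = sample_e n \<sigma> y z1;
          J = max_level n;
          j = hat_level n \<sigma> l s;
          i = loc_index n l j
      in if check_level n \<sigma> l s < \<infinity>
         then - 1 / (2 * real n)
              + 1 / real n * (2 ^ (J - j) * real_of_int i - 2 powi (int J - int j - 1))
         else 1 / real n * real_of_int (arg_min_on (\<lambda>k. e (k - 1)) {i - 2 .. i + 2})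
              - 1 / real n)"

definition Z_hat_risk :: "nat \<Rightarrow> real \<Rightarrow> (real \<Rightarrow> real) \<Rightarrow> ennreal" where
  "Z_hat_risk n \<sigma> f =
     (\<integral>\<^sup>+ (y, z1, z2). ennreal \<bar>Z_hat n \<sigma> y z1 z2 - minimizer f\<bar>
        \<partial>(data_law n \<sigma> f \<Otimes>\<^sub>M (noise n \<Otimes>\<^sub>M noise n)))"

end

theory Submission
  imports Defs
begin

text \<open>
  Let \<open>u\<close> be the height with \<open>\<Sum>\<^sub>i (u - f x\<^sub>i)\<^sub>+\<^sup>2 = \<sigma>\<^sup>2\<close>, let \<open>H = u - min f\<close>, and let \<open>\<rho>\<close> be the radius
  of the level set \<open>f \<le> u\<close> around the minimizer. Cutting \<open>f\<close> off at \<open>u\<close> and tilting it slightly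
  gives a function at bounded Kullback--Leibler distance whose minimizer is any prescribed point of
  the level set; the two-point argument bounds the benchmark below by a multiple of \<open>\<rho>\<close>.

  For the upper bound, blocks of \<open>m > n\<rho>\<close> points on the same side of the minimizer differ in mean by
  at least \<open>m\<^sup>2 H / (n\<rho>)\<close> by convexity, against noise of order \<open>\<surd>m \<sigma>\<close>, while \<open>\<sigma>\<^sup>2 \<le> (2n\<rho> + 1) H\<^sup>2\<close>.
  Leaving the neighbourhood of the minimizer, or stopping, at such a level costs an error of order
  \<open>m/n\<close> and forces a large noise in one of boundedly many fixed blocks, so by Chebyshev's inequality
  the expected costs form a geometric series dominated by \<open>\<rho>\<close>. On finer levels the estimate moves
  by \<open>O(\<rho>)\<close> only, whatever the procedure does. Chebyshev's inequality is used pointwise: the error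
  is bounded by a quadratic polynomial in the noise, which also avoids measurability questions
  about the estimator.
\<close>

subsection \<open>Gaussian product measures\<close>


interpretation std_normal: prob_space std_normal_distribution
  by (rule prob_space_normal_density) simp

interpretation std_normal_product: product_prob_space "\<lambda>_. std_normal_distribution" I for I :: "nat set"
  by unfold_locales

text \<open>Only the first two moments enter. The summand \<open>d\<close> carries the variance of
  coordinates integrated before this one.\<close>

lemma nn_integral_std_normal_square:
  assumes "d \<ge> 0"
  shows "(\<integral>\<^sup>+x. ennreal ((c + t * x)\<^sup>2 + d) \<partial>std_normal_distribution) = ennreal (c\<^sup>2 + t\<^sup>2 + d)"
proof -
  have 1: "integrable std_normal_distribution (\<lambda>x. x)" "(LINT x|std_normal_distribution. x) = 0"
    using integrable_std_normal_distribution_moment[of 1] integral_std_normal_distribution_moment_odd[of 1]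
    by simp_all
  have 2: "integrable std_normal_distribution (\<lambda>x. x\<^sup>2)" "(LINT x|std_normal_distribution. x\<^sup>2) = 1"
    using std_normal_distribution_even_moments[of 1] by simp_all
  have nonneg: "0 \<le> (c + t * x)\<^sup>2 + d" for x using assms by simp
  have eq: "(c + t * x)\<^sup>2 + d = (c\<^sup>2 + d) + (2 * c * t) * x + t\<^sup>2 * x\<^sup>2" for x
    by (simp add: power2_eq_square algebra_simps)
  have "(\<integral>\<^sup>+x. ennreal ((c + t * x)\<^sup>2 + d) \<partial>std_normal_distribution)
      = ennreal (LINT x|std_normal_distribution. (c + t * x)\<^sup>2 + d)"
  proof (rule nn_integral_eq_integral)
    show "integrable std_normal_distribution (\<lambda>x. (c + t * x)\<^sup>2 + d)"
      using 1 2 by (simp add: eq)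
  qed (use nonneg in simp)
  also have "(LINT x|std_normal_distribution. (c + t * x)\<^sup>2 + d) = c\<^sup>2 + t\<^sup>2 + d"
    using 1 2 by (simp add: eq std_normal.prob_space[simplified])
  finally show ?thesis .
qed

lemma nn_integral_PiM_std_normal_square:
  fixes I :: "nat set"
  assumes "finite I"
  shows "(\<integral>\<^sup>+z. ennreal ((c + (\<Sum>i\<in>I. t i * z i))\<^sup>2) \<partial>(\<Pi>\<^sub>M i\<in>I. std_normal_distribution))
    = ennreal (c\<^sup>2 + (\<Sum>i\<in>I. (t i)\<^sup>2))"
  using assms
\<comment> \<open>The constant must vary: with the split-off coordinate fixed at \<open>y\<close>,
  the inner integral has the constant \<open>c + t i * y\<close>.\<close>
proof (induction I arbitrary: c)
  case empty
  have "prob_space (\<Pi>\<^sub>M i\<in>({}::nat set). std_normal_distribution)"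
    by (intro prob_space_PiM prob_space_normal_density) simp
  then show ?case by (simp add: prob_space.emeasure_space_1)
next
  case (insert i I)
  let ?N = "std_normal_distribution"
  have "(\<integral>\<^sup>+z. ennreal ((c + (\<Sum>i\<in>insert i I. t i * z i))\<^sup>2) \<partial>(\<Pi>\<^sub>M i\<in>insert i I. ?N))
    = (\<integral>\<^sup>+y. (\<integral>\<^sup>+x. ennreal ((c + (\<Sum>j\<in>insert i I. t j * (x(i := y)) j))\<^sup>2) \<partial>(\<Pi>\<^sub>M i\<in>I. ?N)) \<partial>?N)"
    using insert.hyps by (intro std_normal_product.product_nn_integral_insert_rev) auto
  also have "\<dots> = (\<integral>\<^sup>+y. (\<integral>\<^sup>+x. ennreal (((c + t i * y) + (\<Sum>j\<in>I. t j * x j))\<^sup>2) \<partial>(\<Pi>\<^sub>M i\<in>I. ?N)) \<partial>?N)"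
  proof -
    have "(\<Sum>j\<in>insert i I. t j * (x(i := y)) j) = t i * y + (\<Sum>j\<in>I. t j * x j)" for x y
      using insert.hyps by (auto intro!: sum.cong)
    then show ?thesis by (simp only: add.assoc)
  qed
  also have "\<dots> = (\<integral>\<^sup>+y. ennreal ((c + t i * y)\<^sup>2 + (\<Sum>j\<in>I. (t j)\<^sup>2)) \<partial>?N)"
    by (simp only: insert.IH)
  also have "\<dots> = ennreal (c\<^sup>2 + (\<Sum>j\<in>insert i I. (t j)\<^sup>2))"
    using insert.hyps by (subst nn_integral_std_normal_square) (auto simp: sum_nonneg add.assoc)
  finally show ?case .
qed

text \<open>The exponential is the quotient of the normal densities with means \<open>t\<close> and
  0.\<close>

lemma std_normal_shift:
  "distr std_normal_distribution borel (\<lambda>x. x + t)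
    = density std_normal_distribution (\<lambda>x. ennreal (exp (t * x - t\<^sup>2 / 2)))"
proof -
  have "distr std_normal_distribution borel (\<lambda>x. x + t) = distr (density lborel std_normal_density) lborel (\<lambda>x. t + 1 * x)"
    by (intro distr_cong) (auto simp: add.commute)
  also have "\<dots> = density lborel (normal_density t 1)"
    using std_normal.normal_density_affine[of "\<lambda>x. x" 0 1 1 t]
    by (simp add: distributed_def distr_id2)
  also have "\<dots> = density std_normal_distribution (\<lambda>x. ennreal (exp (t * x - t\<^sup>2 / 2)))"
  proof -
    have "normal_density t 1 x = std_normal_density x * exp (t * x - t\<^sup>2 / 2)" for x
      by (simp add: normal_density_def mult_exp_exp power2_eq_square field_simps)
    then show ?thesis
      by (simp add: density_density_eq ennreal_mult'')
  qed
  finally show ?thesis .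
qed

text \<open>Finite-dimensional Cameron-Martin formula. The translated law and the law with
  exponential density agree on boxes, so both are the product of the one-dimensional translates
  \<open>D i\<close>.\<close>

lemma nn_integral_PiM_std_normal_shift:
  fixes I :: "nat set"
  assumes I: "finite I" and F[measurable]: "F \<in> borel_measurable (\<Pi>\<^sub>M i\<in>I. borel)"
  shows "(\<integral>\<^sup>+z. F (\<lambda>i\<in>I. z i + t i) \<partial>(\<Pi>\<^sub>M i\<in>I. std_normal_distribution))
    = (\<integral>\<^sup>+z. F z * ennreal (exp (\<Sum>i\<in>I. t i * z i - (t i)\<^sup>2 / 2)) \<partial>(\<Pi>\<^sub>M i\<in>I. std_normal_distribution))"
proof -
  let ?N = "std_normal_distribution"
  define D where "D i = distr ?N borel (\<lambda>x. x + t i)" for i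
  have D': "D i = density ?N (\<lambda>x. ennreal (exp (t i * x - (t i)\<^sup>2 / 2)))" for i
    unfolding D_def by (rule std_normal_shift)
  have prob_D: "prob_space (D i)" for i
    unfolding D_def by (rule std_normal.prob_space_distr) simp
  interpret D: product_prob_space D I
    by (intro product_prob_spaceI prob_D)
  have sets_D: "sets (D i) = sets borel" for i by (simp add: D_def)
  have sN: "sets (\<Pi>\<^sub>M i\<in>I. ?N) = sets (\<Pi>\<^sub>M i\<in>I. borel)"
    by (intro sets_PiM_cong) auto
  have sD: "sets (PiM I D) = sets (\<Pi>\<^sub>M i\<in>I. borel)"
    by (intro sets_PiM_cong) (auto simp: sets_D)
  have F': "F \<in> borel_measurable (\<Pi>\<^sub>M i\<in>I. ?N)"
    using F by (simp add: measurable_cong_sets[OF sN])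
  have shift[measurable]: "(\<lambda>z. \<lambda>i\<in>I. z i + t i) \<in> (\<Pi>\<^sub>M i\<in>I. ?N) \<rightarrow>\<^sub>M (\<Pi>\<^sub>M i\<in>I. borel)"
    by (rule measurable_restrict) simp
  have L: "(\<lambda>z. \<Sum>i\<in>I. t i * z i - (t i)\<^sup>2 / 2) \<in> borel_measurable (\<Pi>\<^sub>M i\<in>I. ?N)"
    by measurable
  have 1: "distr (\<Pi>\<^sub>M i\<in>I. ?N) (\<Pi>\<^sub>M i\<in>I. borel) (\<lambda>z. \<lambda>i\<in>I. z i + t i) = PiM I D"
  proof (rule D.PiM_eqI[OF I])
    show "sets (distr (\<Pi>\<^sub>M i\<in>I. ?N) (\<Pi>\<^sub>M i\<in>I. borel) (\<lambda>z. \<lambda>i\<in>I. z i + t i)) = sets (PiM I D)"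
      by (simp add: sD)
    fix A assume A: "\<And>i. i \<in> I \<Longrightarrow> A i \<in> sets (D i)"
    then have A': "\<And>i. i \<in> I \<Longrightarrow> A i \<in> sets borel" by (simp add: sets_D)
    have "emeasure (distr (\<Pi>\<^sub>M i\<in>I. ?N) (\<Pi>\<^sub>M i\<in>I. borel) (\<lambda>z. \<lambda>i\<in>I. z i + t i)) (Pi\<^sub>E I A)
      = emeasure (\<Pi>\<^sub>M i\<in>I. ?N) ((\<lambda>z. \<lambda>i\<in>I. z i + t i) -` Pi\<^sub>E I A \<inter> space (\<Pi>\<^sub>M i\<in>I. ?N))"
      using A' I by (intro emeasure_distr shift sets_PiM_I_finite) auto
    also have "(\<lambda>z. \<lambda>i\<in>I. z i + t i) -` Pi\<^sub>E I A \<inter> space (\<Pi>\<^sub>M i\<in>I. ?N) = Pi\<^sub>E I (\<lambda>i. (\<lambda>x. x + t i) -` A i)"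
      by (auto simp: space_PiM PiE_iff extensional_def)
    also have "emeasure (\<Pi>\<^sub>M i\<in>I. ?N) \<dots> = (\<Prod>i\<in>I. emeasure ?N ((\<lambda>x. x + t i) -` A i))"
    proof (intro std_normal_product.emeasure_PiM I)
      fix i assume "i \<in> I"
      from A'[OF this] show "(\<lambda>x. x + t i) -` A i \<in> sets ?N"
        using measurable_sets[of "\<lambda>x. x + t i" borel borel "A i"] by simp
    qed
    also have "\<dots> = (\<Prod>i\<in>I. emeasure (D i) (A i))"
      unfolding D_def using A' by (intro prod.cong refl) (simp add: emeasure_distr)
    finally show "emeasure (distr (\<Pi>\<^sub>M i\<in>I. ?N) (\<Pi>\<^sub>M i\<in>I. borel) (\<lambda>z. \<lambda>i\<in>I. z i + t i)) (Pi\<^sub>E I A)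
      = (\<Prod>i\<in>I. emeasure (D i) (A i))" .
  qed
  have 2: "density (\<Pi>\<^sub>M i\<in>I. ?N) (\<lambda>z. ennreal (exp (\<Sum>i\<in>I. t i * z i - (t i)\<^sup>2 / 2))) = PiM I D"
  proof (rule D.PiM_eqI[OF I])
    show "sets (density (\<Pi>\<^sub>M i\<in>I. ?N) (\<lambda>z. ennreal (exp (\<Sum>i\<in>I. t i * z i - (t i)\<^sup>2 / 2)))) = sets (PiM I D)"
      by (simp add: sD sN)
    fix A assume A: "\<And>i. i \<in> I \<Longrightarrow> A i \<in> sets (D i)"
    then have A': "\<And>i. i \<in> I \<Longrightarrow> A i \<in> sets borel" by (simp add: sets_D)
    have [measurable]: "Pi\<^sub>E I A \<in> sets (\<Pi>\<^sub>M i\<in>I. ?N)"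
      using A' I by (intro sets_PiM_I_finite) auto
    have "emeasure (density (\<Pi>\<^sub>M i\<in>I. ?N) (\<lambda>z. ennreal (exp (\<Sum>i\<in>I. t i * z i - (t i)\<^sup>2 / 2)))) (Pi\<^sub>E I A)
      = (\<integral>\<^sup>+z. ennreal (exp (\<Sum>i\<in>I. t i * z i - (t i)\<^sup>2 / 2)) * indicator (Pi\<^sub>E I A) z \<partial>(\<Pi>\<^sub>M i\<in>I. ?N))"
      using L by (intro emeasure_density) auto
    also have "\<dots> = (\<integral>\<^sup>+z. (\<Prod>i\<in>I. ennreal (exp (t i * z i - (t i)\<^sup>2 / 2)) * indicator (A i) (z i)) \<partial>(\<Pi>\<^sub>M i\<in>I. ?N))"
    proof (intro nn_integral_cong)
      fix z assume z: "z \<in> space (\<Pi>\<^sub>M i\<in>I. ?N)"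
      have "(indicator (Pi\<^sub>E I A) z :: ennreal) = (\<Prod>i\<in>I. indicator (A i) (z i))"
        using z I by (auto simp: indicator_def PiE_iff space_PiM)
      then show "ennreal (exp (\<Sum>i\<in>I. t i * z i - (t i)\<^sup>2 / 2)) * indicator (Pi\<^sub>E I A) z
         = (\<Prod>i\<in>I. ennreal (exp (t i * z i - (t i)\<^sup>2 / 2)) * indicator (A i) (z i))"
        using I by (simp add: prod.distrib exp_sum prod_ennreal)
    qed
    also have "\<dots> = (\<Prod>i\<in>I. \<integral>\<^sup>+x. ennreal (exp (t i * x - (t i)\<^sup>2 / 2)) * indicator (A i) x \<partial>?N)"
      using A' I by (intro std_normal_product.product_nn_integral_prod) auto
    also have "\<dots> = (\<Prod>i\<in>I. emeasure (D i) (A i))"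
      unfolding D' using A' by (intro prod.cong refl emeasure_density[symmetric]) auto
    finally show "emeasure (density (\<Pi>\<^sub>M i\<in>I. ?N) (\<lambda>z. ennreal (exp (\<Sum>i\<in>I. t i * z i - (t i)\<^sup>2 / 2)))) (Pi\<^sub>E I A)
      = (\<Prod>i\<in>I. emeasure (D i) (A i))" .
  qed
  have "(\<integral>\<^sup>+z. F (\<lambda>i\<in>I. z i + t i) \<partial>(\<Pi>\<^sub>M i\<in>I. ?N)) = (\<integral>\<^sup>+z. F z \<partial>PiM I D)"
    unfolding 1[symmetric] by (subst nn_integral_distr) auto
  also have "\<dots> = (\<integral>\<^sup>+z. ennreal (exp (\<Sum>i\<in>I. t i * z i - (t i)\<^sup>2 / 2)) * F z \<partial>(\<Pi>\<^sub>M i\<in>I. ?N))"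
    unfolding 2[symmetric] using L F' by (subst nn_integral_density) auto
  finally show ?thesis by (simp add: mult.commute)
qed

subsection \<open>The lower bound on the benchmark\<close>


lemma square_add_le: "(a + b)\<^sup>2 \<le> 2 * a\<^sup>2 + 2 * b\<^sup>2" for a b :: real
  using zero_le_power2[of "a - b"] by (simp add: power2_eq_square algebra_simps)

section \<open>Convex functions and their minimizers\<close>

lemma convex_on_max:
  assumes "convex_on S f" "convex_on S g"
  shows "convex_on S (\<lambda>x. max (f x) (g x))"
  unfolding convex_on_def
proof (intro conjI ballI allI impI)
  show "convex S" using assms(1) by (simp add: convex_on_def)
  fix x y u v
  assume *: "x \<in> S" "y \<in> S" "0 \<le> u" "0 \<le> v" "u + v = (1::real)"
  have "f (u *\<^sub>R x + v *\<^sub>R y) \<le> u * f x + v * f y" "g (u *\<^sub>R x + v *\<^sub>R y) \<le> u * g x + v * g y"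
    using assms * by (simp_all add: convex_on_def)
  moreover have "u * f x \<le> u * max (f x) (g x)" "u * g x \<le> u * max (f x) (g x)"
    "v * f y \<le> v * max (f y) (g y)" "v * g y \<le> v * max (f y) (g y)"
    using * by (auto intro!: mult_left_mono)
  ultimately show "max (f (u *\<^sub>R x + v *\<^sub>R y)) (g (u *\<^sub>R x + v *\<^sub>R y))
      \<le> u * max (f x) (g x) + v * max (f y) (g y)"
    by linarith
qed

lemma minimizer_eqI:
  assumes "t \<in> {0..1}" "\<And>s. s \<in> {0..1} \<Longrightarrow> s \<noteq> t \<Longrightarrow> f t < f s"
  shows "minimizer f = t"
proof -
  have "is_arg_min f (\<lambda>t. t \<in> {0..1}) t"
    using assms unfolding is_arg_min_def by (metis less_asym)
  then have "is_arg_min f (\<lambda>t. t \<in> {0..1}) (minimizer f)"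
    unfolding minimizer_def arg_min_on_def arg_min_def by (rule someI)
  then show ?thesis
    using assms unfolding is_arg_min_def by metis
qed

lemma convex_class_I:
  assumes "convex_on {0..1} f" "t \<in> {0..1}" "\<And>s. s \<in> {0..1} \<Longrightarrow> s \<noteq> t \<Longrightarrow> f t < f s"
  shows "f \<in> convex_class"
proof -
  have "\<exists>!t. is_arg_min f (\<lambda>t. t \<in> {0..1}) t"
  proof (rule ex1I[of _ t])
    show "is_arg_min f (\<lambda>t. t \<in> {0..1}) t"
      using assms unfolding is_arg_min_def by (metis less_asym)
    show "s = t" if "is_arg_min f (\<lambda>t. t \<in> {0..1}) s" for s
      using assms that unfolding is_arg_min_def by metis
  qed
  then show ?thesis using assms(1) by (simp add: convex_class_def)
qed

lemma
  assumes "f \<in> convex_class"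
  shows minimizer_in_unit_interval: "minimizer f \<in> {0..1}"
    and minimizer_le: "\<And>t. t \<in> {0..1} \<Longrightarrow> f (minimizer f) \<le> f t"
proof -
  from assms obtain t where "is_arg_min f (\<lambda>t. t \<in> {0..1}) t"
    by (auto simp: convex_class_def)
  then have "is_arg_min f (\<lambda>t. t \<in> {0..1}) (minimizer f)"
    unfolding minimizer_def arg_min_on_def arg_min_def by (rule someI)
  then show "minimizer f \<in> {0..1}" "\<And>t. t \<in> {0..1} \<Longrightarrow> f (minimizer f) \<le> f t"
    unfolding is_arg_min_def by (auto simp: not_less)
qed

section \<open>The law of the design noise\<close>

lemma prob_space_noise: "prob_space (noise n)"
  unfolding noise_def by (intro prob_space_PiM prob_space_normal_density) simp

lemma sets_noise [measurable_cong]: "sets (noise n) = sets (\<Pi>\<^sub>M i\<in>{0..n}. borel)"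
  unfolding noise_def by (intro sets_PiM_cong) auto

lemma measurable_noise_component [measurable]:
  "i \<le> n \<Longrightarrow> (\<lambda>z. z i) \<in> borel_measurable (noise n)"
  by (subst measurable_cong_sets[OF sets_noise refl]) (rule measurable_component_singleton, simp)

lemma measurable_affine_noise [measurable]:
  "(\<lambda>z. \<lambda>i\<in>{0..n}. h i + \<sigma> * z i) \<in> noise n \<rightarrow>\<^sub>M (\<Pi>\<^sub>M i\<in>{0..n}. borel)"
  by (rule measurable_restrict) simp

lemma nn_integral_noise_square:
  "(\<integral>\<^sup>+z. ennreal ((\<Sum>i\<in>{0..n}. t i * z i)\<^sup>2) \<partial>noise n) = ennreal (\<Sum>i\<in>{0..n}. (t i)\<^sup>2)"
  using nn_integral_PiM_std_normal_square[of "{0..n}" 0 t] by (simp add: noise_def)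

text \<open>Le Cam's two-point argument. The likelihood ratio is \<open>exp (X - q / 2)\<close>,
  where \<open>X\<close> is centred with variance \<open>q \<le> 3\<close>. It is at least
  \<open>exp (-9/2)\<close> outside an event to which Chebyshev's inequality gives probability at
  most 1/3.\<close>

lemma two_point_bound:
  assumes \<sigma>: "\<sigma> > 0" and \<delta>: "\<delta> \<in> estimators n"
    and close: "(\<Sum>i\<in>{0..n}. (g (real i / real n) - f (real i / real n))\<^sup>2) \<le> 3 * \<sigma>\<^sup>2"
  shows "ennreal (exp (-9/2) / 3 * \<bar>minimizer g - minimizer f\<bar>) \<le> max (risk n \<sigma> f \<delta>) (risk n \<sigma> g \<delta>)"
proof -
  define a b where "a = minimizer f" and "b = minimizer g"
  define d where "d = \<bar>b - a\<bar>"
  define t where "t i = (g (real i / real n) - f (real i / real n)) / \<sigma>" for i :: nat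
  define X where "X z = (\<Sum>i\<in>{0..n}. t i * z i)" for z :: "nat \<Rightarrow> real"
  define q where "q = (\<Sum>i\<in>{0..n}. (t i)\<^sup>2)"
  have q: "0 \<le> q" "q \<le> 3"
  proof -
    have "q = (\<Sum>i\<in>{0..n}. (g (real i / real n) - f (real i / real n))\<^sup>2) / \<sigma>\<^sup>2"
      by (simp add: q_def t_def power_divide sum_divide_distrib)
    also have "\<dots> \<le> 3 * \<sigma>\<^sup>2 / \<sigma>\<^sup>2" by (intro divide_right_mono close) simp
    finally show "q \<le> 3" using \<sigma> by simp
  qed (simp add: q_def sum_nonneg)
  have [measurable]: "\<delta> \<in> borel_measurable (\<Pi>\<^sub>M i\<in>{0..n}. borel)"
    using \<delta> by (simp add: estimators_def)
  have [measurable]: "X \<in> borel_measurable (noise n)"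
    unfolding X_def by (intro borel_measurable_sum borel_measurable_times) auto
  define Y where "Y z = \<delta> (\<lambda>i\<in>{0..n}. f (real i / real n) + \<sigma> * z i)" for z
  have [measurable]: "Y \<in> borel_measurable (\<Pi>\<^sub>M i\<in>{0..n}. borel)"
    unfolding Y_def
    by (rule measurable_compose[OF measurable_restrict \<open>\<delta> \<in> borel_measurable (\<Pi>\<^sub>M i\<in>{0..n}. borel)\<close>]) measurable
  have rf: "risk n \<sigma> f \<delta> = (\<integral>\<^sup>+z. ennreal \<bar>Y z - a\<bar> \<partial>noise n)"
    unfolding risk_def data_law_def a_def Y_def by (subst nn_integral_distr) auto
  \<comment> \<open>Data under \<open>g\<close> are data under \<open>f\<close> with noise
    translated by \<open>t\<close>, so both risks become integrals against the same noise
    law.\<close>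
  have "risk n \<sigma> g \<delta> = (\<integral>\<^sup>+z. ennreal \<bar>Y (\<lambda>i\<in>{0..n}. z i + t i) - b\<bar> \<partial>noise n)"
  proof -
    have "(\<lambda>i\<in>{0..n}. f (real i / real n) + \<sigma> * (\<lambda>i\<in>{0..n}. z i + t i) i)
        = (\<lambda>i\<in>{0..n}. g (real i / real n) + \<sigma> * z i)" for z
      using \<sigma> by (auto simp: t_def field_simps restrict_def fun_eq_iff)
    then show ?thesis
      unfolding risk_def data_law_def b_def Y_def by (subst nn_integral_distr) auto
  qed
  also have "\<dots> = (\<integral>\<^sup>+z. ennreal \<bar>Y z - b\<bar> * ennreal (exp (\<Sum>i\<in>{0..n}. t i * z i - (t i)\<^sup>2 / 2)) \<partial>noise n)"
    unfolding noise_def by (rule nn_integral_PiM_std_normal_shift) auto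
  also have "\<dots> = (\<integral>\<^sup>+z. ennreal (\<bar>Y z - b\<bar> * exp (X z - q / 2)) \<partial>noise n)"
    by (simp add: X_def q_def sum_subtractf sum_divide_distrib ennreal_mult)
  finally have rg: "risk n \<sigma> g \<delta> = (\<integral>\<^sup>+z. ennreal (\<bar>Y z - b\<bar> * exp (X z - q / 2)) \<partial>noise n)" .
  define e where "e = exp (-9/2 :: real)"
  have e: "0 < e" "e \<le> 1" by (auto simp: e_def)
  \<comment> \<open>For \<open>\<bar>X z\<bar> \<le> 3\<close> the likelihood ratio is at least
    \<open>e\<close> and the triangle inequality applies; otherwise the quadratic term alone reaches
    \<open>e * d\<close>.\<close>
  have pointwise: "e * d \<le> \<bar>Y z - a\<bar> + \<bar>Y z - b\<bar> * exp (X z - q / 2) + e * d / 9 * (X z)\<^sup>2" for z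
  proof (cases "\<bar>X z\<bar> \<le> 3")
    case True
    have "e \<le> exp (X z - q / 2)" using q True unfolding e_def by (subst exp_le_cancel_iff) linarith
    then have "\<bar>Y z - b\<bar> * e \<le> \<bar>Y z - b\<bar> * exp (X z - q / 2)" by (intro mult_left_mono) auto
    moreover have "\<bar>Y z - a\<bar> * e \<le> \<bar>Y z - a\<bar> * 1" using e by (intro mult_left_mono) auto
    moreover have "e * d \<le> e * (\<bar>Y z - a\<bar> + \<bar>Y z - b\<bar>)"
      using e by (intro mult_left_mono) (auto simp: d_def)
    moreover have "0 \<le> e * d / 9 * (X z)\<^sup>2" using e by (simp add: d_def)
    ultimately show ?thesis by (simp add: algebra_simps)
  next
    case False
    then have "3\<^sup>2 \<le> \<bar>X z\<bar>\<^sup>2" by (intro power_mono) auto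
    then have "e * d / 9 * 9 \<le> e * d / 9 * (X z)\<^sup>2"
      using e by (intro mult_left_mono) (auto simp: d_def)
    moreover have "0 \<le> \<bar>Y z - b\<bar> * exp (X z - q / 2)" by simp
    moreover have "e * d / 9 * 9 = e * d" by simp
    ultimately show ?thesis by linarith
  qed
  interpret N: prob_space "noise n" by (rule prob_space_noise)
  have "ennreal (e * d) = (\<integral>\<^sup>+z. ennreal (e * d) \<partial>noise n)"
    by (simp add: N.emeasure_space_1)
  also have "\<dots> \<le> (\<integral>\<^sup>+z. ennreal \<bar>Y z - a\<bar> + ennreal (\<bar>Y z - b\<bar> * exp (X z - q / 2))
      + ennreal (e * d / 9) * ennreal ((X z)\<^sup>2) \<partial>noise n)"
    using pointwise e
    by (intro nn_integral_mono) (simp add: d_def flip: ennreal_plus ennreal_mult)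
  also have "\<dots> = risk n \<sigma> f \<delta> + risk n \<sigma> g \<delta> + ennreal (e * d / 9) * ennreal q"
    unfolding rf rg
    by (simp add: nn_integral_add nn_integral_cmult X_def q_def nn_integral_noise_square)
  also have "\<dots> \<le> risk n \<sigma> f \<delta> + risk n \<sigma> g \<delta> + ennreal (e * d / 3)"
  proof (rule add_left_mono)
    have "e * d / 9 * q \<le> e * d / 9 * 3" using q e by (intro mult_left_mono) (auto simp: d_def)
    then show "ennreal (e * d / 9) * ennreal q \<le> ennreal (e * d / 3)"
      using q e by (auto simp: d_def simp flip: ennreal_mult intro!: ennreal_leI)
  qed
  also have "\<dots> \<le> 2 * max (risk n \<sigma> f \<delta>) (risk n \<sigma> g \<delta>) + ennreal (e * d / 3)"
    unfolding mult_2 by (intro add_mono order_refl) auto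
  finally have *: "ennreal (e * d) \<le> 2 * max (risk n \<sigma> f \<delta>) (risk n \<sigma> g \<delta>) + ennreal (e * d / 3)" .
  show ?thesis
  proof (cases "max (risk n \<sigma> f \<delta>) (risk n \<sigma> g \<delta>)")
    case (real r)
    then have "e * d \<le> 2 * r + e * d / 3"
      using * e by (simp add: d_def flip: ennreal_plus ennreal_numeral ennreal_mult)
    then show ?thesis using real e by (simp add: d_def e_def a_def b_def)
  qed simp
qed

text \<open>The comparison function is \<open>f\<close> cut off at height \<open>u\<close> and tilted slightly, so that its
  minimizer becomes the prescribed point \<open>t\<close> of the level set.\<close>

lemma benchmark_ge_level_set:
  assumes n: "n \<ge> 1" and \<sigma>: "\<sigma> > 0" and f: "f \<in> convex_class"
    and t: "t \<in> {0..1}" "f t \<le> u"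
    and u: "(\<Sum>i\<in>{0..n}. (max 0 (u - f (real i / real n)))\<^sup>2) \<le> \<sigma>\<^sup>2"
  shows "ennreal (exp (-9/2) / 3 * \<bar>t - minimizer f\<bar>) \<le> benchmark n \<sigma> f"
proof -
  \<comment> \<open>So small that the tilt adds at most \<open>\<sigma>\<^sup>2\<close> to the sum
    of squares, besides the at most \<open>2 * \<sigma>\<^sup>2\<close> from the cut-off; together
    they give the bound required by \<open>two_point_bound\<close>.\<close>
  define \<epsilon> where "\<epsilon> = \<sigma> / (2 * (real n + 1))"
  have \<epsilon>: "\<epsilon> > 0" using \<sigma> by (simp add: \<epsilon>_def)
  define g where "g x = max (f x) u + \<epsilon> * \<bar>x - t\<bar>" for x
  have cvx: "convex_on {0..1} g"
  proof -
    have "convex_on {0..1} (\<lambda>x. max (f x) u)"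
      using f by (intro convex_on_max) (auto simp: convex_class_def convex_on_const)
    moreover have "convex_on {0..1} (\<lambda>x. \<epsilon> * \<bar>x - t\<bar>)"
    proof -
      have "convex_on {0..1} (\<lambda>x. dist t x)" by (rule convex_on_dist) simp
      then show ?thesis using \<epsilon>
        by (intro convex_on_cmul) (auto simp: dist_real_def abs_minus_commute)
    qed
    ultimately show ?thesis unfolding g_def by (rule convex_on_add)
  qed
  have gt: "g t < g s" if "s \<noteq> t" for s
  proof -
    have "0 < \<epsilon> * \<bar>s - t\<bar>" using that \<epsilon> by simp
    then show ?thesis using t(2) unfolding g_def by (simp add: max_def)
  qed
  have g: "g \<in> convex_class" using cvx t(1) gt by (rule convex_class_I)
  have mg: "minimizer g = t" using t(1) gt by (rule minimizer_eqI)
  have "(\<Sum>i\<in>{0..n}. (g (real i / real n) - f (real i / real n))\<^sup>2)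
      \<le> (\<Sum>i\<in>{0..n}. 2 * (max 0 (u - f (real i / real n)))\<^sup>2 + 2 * \<epsilon>\<^sup>2)"
  proof (rule sum_mono)
    fix i assume i: "i \<in> {0..n}"
    let ?x = "real i / real n"
    have x: "0 \<le> ?x" "?x \<le> 1" using i n by auto
    have "g ?x - f ?x = max 0 (u - f ?x) + \<epsilon> * \<bar>?x - t\<bar>" by (simp add: g_def max_def)
    also have "\<dots>\<^sup>2 \<le> 2 * (max 0 (u - f ?x))\<^sup>2 + 2 * (\<epsilon> * \<bar>?x - t\<bar>)\<^sup>2"
      by (rule square_add_le)
    also have "(\<epsilon> * \<bar>?x - t\<bar>)\<^sup>2 \<le> \<epsilon>\<^sup>2"
    proof (rule power_mono)
      have "\<bar>?x - t\<bar> \<le> 1" using x t(1) unfolding atLeastAtMost_iff by linarith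
      then show "\<epsilon> * \<bar>?x - t\<bar> \<le> \<epsilon>" using \<epsilon> by (simp add: mult_left_le)
    qed (use \<epsilon> in simp)
    finally show "(g ?x - f ?x)\<^sup>2 \<le> 2 * (max 0 (u - f ?x))\<^sup>2 + 2 * \<epsilon>\<^sup>2" by simp
  qed
  also have "\<dots> = 2 * (\<Sum>i\<in>{0..n}. (max 0 (u - f (real i / real n)))\<^sup>2) + 2 * (real n + 1) * \<epsilon>\<^sup>2"
    by (simp add: sum.distrib sum_distrib_left algebra_simps)
  also have "2 * (real n + 1) * \<epsilon>\<^sup>2 \<le> \<sigma>\<^sup>2"
  proof -
    have "2 * (real n + 1) * \<epsilon>\<^sup>2 = \<sigma>\<^sup>2 / (2 * (real n + 1))"
    proof -
      have "2 * c * (\<sigma> / (2 * c))\<^sup>2 = \<sigma>\<^sup>2 / (2 * c)" if "c > 0" for c :: real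
        using that by (simp add: power2_eq_square field_simps)
      from this[of "real n + 1"] show ?thesis by (simp add: \<epsilon>_def)
    qed
    also have "\<dots> \<le> \<sigma>\<^sup>2 / 1" by (intro divide_left_mono) auto
    finally show ?thesis by simp
  qed
  finally have close: "(\<Sum>i\<in>{0..n}. (g (real i / real n) - f (real i / real n))\<^sup>2) \<le> 3 * \<sigma>\<^sup>2"
    using u by simp
  have "ennreal (exp (-9/2) / 3 * \<bar>t - minimizer f\<bar>)
      \<le> (INF \<delta>\<in>estimators n. max (risk n \<sigma> f \<delta>) (risk n \<sigma> g \<delta>))"
    using two_point_bound[OF \<sigma> _ close] by (intro INF_greatest) (simp add: mg)
  also have "\<dots> \<le> benchmark n \<sigma> f"
    unfolding benchmark_def by (intro SUP_upper g)
  finally show ?thesis .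
qed

subsection \<open>Growth of a convex function away from its minimizer\<close>


text \<open>
  \<open>H\<close> is the height, above the minimum, at which the squared depth of \<open>f\<close> below that height
  sums up to \<open>\<sigma>\<^sup>2\<close> over the design points, and \<open>\<rho>\<close> is the radius of the corresponding level set
  around the minimizer.
\<close>

locale level_set_profile =
  fixes n :: nat and \<sigma> :: real and f :: "real \<Rightarrow> real" and H \<rho> :: real
  assumes n: "n \<ge> 1" and \<sigma>: "\<sigma> > 0" and f: "f \<in> convex_class"
    and H: "H > 0" and \<rho>: "\<rho> > 0"
    and growth: "\<And>t. t \<in> {0..1} \<Longrightarrow> \<rho> < \<bar>t - minimizer f\<bar> \<Longrightarrow>
      H * \<bar>t - minimizer f\<bar> \<le> (f t - f (minimizer f)) * \<rho>"
    and near: "\<exists>k\<le>n. \<bar>real k / real n - minimizer f\<bar> \<le> \<rho> \<and> f (real k / real n) \<le> f (minimizer f) + H"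
    and noise_le: "\<sigma>\<^sup>2 \<le> (2 * real n * \<rho> + 1) * H\<^sup>2"

lemma convex_class_segment:
  assumes f: "f \<in> convex_class" and p: "p \<in> {0..1}" and s: "0 \<le> s" "s \<le> 1"
  defines "Z \<equiv> minimizer f"
  shows "Z + s * (p - Z) \<in> {0..1}" and "f (Z + s * (p - Z)) \<le> f Z + s * (f p - f Z)"
proof -
  have Z: "Z \<in> {0..1}" unfolding Z_def using f by (rule minimizer_in_unit_interval)
  have eq: "Z + s * (p - Z) = (1 - s) *\<^sub>R Z + s *\<^sub>R p" by (simp add: algebra_simps)
  show "Z + s * (p - Z) \<in> {0..1}"
    unfolding eq using Z p s by (intro convexD_alt convex_real_interval) auto
  have "f (Z + s * (p - Z)) \<le> (1 - s) * f Z + s * f p"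
    unfolding eq using f Z p s by (intro convex_onD[of "{0..1}"]) (auto simp: convex_class_def)
  then show "f (Z + s * (p - Z)) \<le> f Z + s * (f p - f Z)" by (simp add: algebra_simps)
qed

text \<open>An interval of length \<open>2 * real n * \<rho>\<close> contains at most that many
  integers plus one.\<close>

lemma card_design_points_le:
  assumes n: "n \<ge> 1" and \<rho>: "\<rho> \<ge> 0"
  shows "real (card {k\<in>{0..n}. \<bar>real k / real n - Z\<bar> \<le> \<rho>}) \<le> 2 * real n * \<rho> + 1"
proof -
  let ?K = "{k\<in>{0..n}. \<bar>real k / real n - Z\<bar> \<le> \<rho>}"
  let ?a = "real n * Z - real n * \<rho>" and ?b = "real n * Z + real n * \<rho>"
  have "int ` ?K \<subseteq> {\<lceil>?a\<rceil>..\<lfloor>?b\<rfloor>}"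
  proof
    fix i assume "i \<in> int ` ?K"
    then obtain k where k: "i = int k" "\<bar>real k / real n - Z\<bar> \<le> \<rho>" by auto
    have "real n * \<bar>real k / real n - Z\<bar> \<le> real n * \<rho>" using k by (intro mult_left_mono) auto
    moreover have "real n * \<bar>real k / real n - Z\<bar> = \<bar>real k - real n * Z\<bar>"
      using n by (simp add: abs_mult_pos' algebra_simps)
    ultimately show "i \<in> {\<lceil>?a\<rceil>..\<lfloor>?b\<rfloor>}" unfolding k by (simp add: ceiling_le_iff le_floor_iff abs_le_iff)
  qed
  then have "card (int ` ?K) \<le> card {\<lceil>?a\<rceil>..\<lfloor>?b\<rfloor>}" by (intro card_mono) auto
  moreover have "card (int ` ?K) = card ?K" by (rule card_image) simp
  moreover have "real (card {\<lceil>?a\<rceil>..\<lfloor>?b\<rfloor>}) \<le> max 0 (real_of_int (\<lfloor>?b\<rfloor> - \<lceil>?a\<rceil> + 1))"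
    by simp
  moreover have "real_of_int (\<lfloor>?b\<rfloor> - \<lceil>?a\<rceil> + 1) \<le> ?b - ?a + 1"
    using of_int_floor_le[of ?b] le_of_int_ceiling[of ?a] unfolding of_int_add of_int_diff of_int_1 by linarith
  moreover have "?b - ?a + 1 = 2 * real n * \<rho> + 1" by simp
  moreover have "0 \<le> 2 * real n * \<rho> + 1" using \<rho> by simp
  ultimately show ?thesis by linarith
qed

text \<open>The height comes from the intermediate value theorem and \<open>\<rho>\<close> is a
  supremum over the level set. Since \<open>benchmark_ge_level_set\<close> bounds the distance of
  every point of that set, the bound passes to the supremum.\<close>

lemma exists_level_set_profile:
  assumes n: "n \<ge> 1" and \<sigma>: "\<sigma> > 0" and f: "f \<in> convex_class"
  obtains H \<rho> where "level_set_profile n \<sigma> f H \<rho>"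
    and "ennreal (exp (-9/2) / 3 * \<rho>) \<le> benchmark n \<sigma> f"
proof -
  define Z where "Z = minimizer f"
  have Z: "Z \<in> {0..1}" unfolding Z_def using f by (rule minimizer_in_unit_interval)
  have minZ: "f Z \<le> f t" if "t \<in> {0..1}" for t
    unfolding Z_def using f that by (rule minimizer_le)
  define v where "v k = f (real k / real n)" for k
  have design: "real k / real n \<in> {0..1}" if "k \<le> n" for k
    using that n by simp
  define S where "S u = (\<Sum>k\<in>{0..n}. (max 0 (u - v k))\<^sup>2)" for u
  obtain k0 where k0: "k0 \<le> n" "\<And>k. k \<le> n \<Longrightarrow> v k0 \<le> v k"
    using ex_min_if_finite[of "v ` {0..n}"] by (force simp: not_less)
  \<comment> \<open>At the lowest design value the sum vanishes; at a height \<open>\<sigma>\<close>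
    above it, the lowest design point alone contributes \<open>\<sigma>\<^sup>2\<close>.\<close>
  have "\<exists>u\<ge>v k0. u \<le> v k0 + \<sigma> \<and> S u = \<sigma>\<^sup>2"
  proof (rule IVT')
    have "S (v k0) = 0" unfolding S_def using k0 by (intro sum.neutral) auto
    then show "S (v k0) \<le> \<sigma>\<^sup>2" by simp
    have "\<sigma>\<^sup>2 = (max 0 (v k0 + \<sigma> - v k0))\<^sup>2" using \<sigma> by simp
    also have "\<dots> \<le> S (v k0 + \<sigma>)"
      unfolding S_def using k0 by (intro member_le_sum) auto
    finally show "\<sigma>\<^sup>2 \<le> S (v k0 + \<sigma>)" .
    show "continuous_on {v k0..v k0 + \<sigma>} S"
      unfolding S_def by (intro continuous_intros)
  qed (use \<sigma> in simp)
  then obtain u where u: "v k0 \<le> u" "S u = \<sigma>\<^sup>2" by blast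
  have "u \<noteq> v k0"
  proof
    assume "u = v k0"
    then have "S u = 0" unfolding S_def using k0 by (intro sum.neutral) auto
    then show False using u \<sigma> by simp
  qed
  then have u_gt: "v k0 < u" using u by simp
  define H where "H = u - f Z"
  have H: "H > 0"
    using u_gt minZ[OF design[OF k0(1)]] by (simp add: H_def v_def)
  define L where "L = {t\<in>{0..1}. f t \<le> u}"
  define \<rho> where "\<rho> = (SUP t\<in>L. \<bar>t - Z\<bar>)"
  have bdd: "bdd_above ((\<lambda>t. \<bar>t - Z\<bar>) ` L)"
    using Z by (intro bdd_aboveI[of _ 1]) (auto simp: L_def)
  have in_L: "\<bar>t - Z\<bar> \<le> \<rho>" if "t \<in> {0..1}" "f t \<le> u" for t
    unfolding \<rho>_def using that bdd by (intro cSUP_upper) (auto simp: L_def)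
  have "Z \<in> L" using Z H by (simp add: L_def H_def)
  \<comment> \<open>A short move from \<open>Z\<close> towards another point \<open>p\<close> stays
    below height \<open>u\<close>. The added 1 keeps the denominator of \<open>s\<close> positive,
    given only \<open>f Z \<le> f p\<close>.\<close>
  have \<rho>: "\<rho> > 0"
  proof -
    obtain p where p: "p \<in> {0..1}" "p \<noteq> Z"
      by (cases "Z = 0") (auto intro: that[of 1] that[of 0])
    define s where "s = min 1 (H / (f p - f Z + 1))"
    have s: "0 < s" "s \<le> 1" using H minZ[OF p(1)] by (auto simp: s_def)
    have "s * (f p - f Z) \<le> H / (f p - f Z + 1) * (f p - f Z)"
      using minZ[OF p(1)] by (intro mult_right_mono) (auto simp: s_def)
    also have "\<dots> \<le> H" using H minZ[OF p(1)] by (simp add: field_simps)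
    finally have "f Z + s * (f p - f Z) \<le> u" by (simp add: H_def)
    then have "\<bar>Z + s * (p - Z) - Z\<bar> \<le> \<rho>"
      using convex_class_segment[OF f p(1), of s, folded Z_def] s by (intro in_L) auto
    moreover have "0 < \<bar>Z + s * (p - Z) - Z\<bar>" using s p by simp
    ultimately show ?thesis by linarith
  qed
  \<comment> \<open>If growth were slower, convexity would put a point at distance
    \<open>r > \<rho>\<close> from \<open>Z\<close> at height at most \<open>u\<close>, against the
    choice of \<open>\<rho>\<close>.\<close>
  have growth: "H * \<bar>t - Z\<bar> \<le> (f t - f Z) * \<rho>" if t: "t \<in> {0..1}" "\<rho> < \<bar>t - Z\<bar>" for t
  proof (rule ccontr)
    assume "\<not> ?thesis"
    then have lt: "(f t - f Z) * \<rho> < H * \<bar>t - Z\<bar>" by simp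
    have pos: "0 < f t - f Z"
      using in_L[of t] t H by (force simp: H_def)
    define r where "r = min \<bar>t - Z\<bar> (H * \<bar>t - Z\<bar> / (f t - f Z))"
    have r: "\<rho> < r" "r \<le> \<bar>t - Z\<bar>" using t lt pos by (auto simp: r_def field_simps)
    have r2: "r * (f t - f Z) \<le> H * \<bar>t - Z\<bar>"
    proof -
      have "r \<le> H * \<bar>t - Z\<bar> / (f t - f Z)" by (simp add: r_def)
      then show ?thesis using pos by (simp add: field_simps)
    qed
    define s where "s = r / \<bar>t - Z\<bar>"
    have s: "0 \<le> s" "s \<le> 1" using r \<rho> by (auto simp: s_def)
    have "s * (f t - f Z) \<le> H"
      using r2 r \<rho> by (simp add: s_def field_simps)
    then have "\<bar>Z + s * (t - Z) - Z\<bar> \<le> \<rho>"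
      using convex_class_segment[OF f t(1) s, folded Z_def] by (intro in_L) (auto simp: H_def)
    moreover have "\<bar>Z + s * (t - Z) - Z\<bar> = r"
      using s r \<rho> by (simp add: abs_mult) (simp add: s_def)
    ultimately show False using r by simp
  qed
  have noise_le: "\<sigma>\<^sup>2 \<le> (2 * real n * \<rho> + 1) * H\<^sup>2"
  proof -
    let ?K = "{k\<in>{0..n}. \<bar>real k / real n - Z\<bar> \<le> \<rho>}"
    \<comment> \<open>Design points farther than \<open>\<rho>\<close> lie above \<open>u\<close>
      and contribute nothing; each other point contributes at most \<open>H\<^sup>2\<close>.\<close>
    have "\<sigma>\<^sup>2 = (\<Sum>k\<in>?K. (max 0 (u - v k))\<^sup>2)"
      unfolding u(2)[symmetric] S_def
      using in_L design by (intro sum.mono_neutral_right) (auto simp: v_def not_le)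
    also have "\<dots> \<le> (\<Sum>k\<in>?K. H\<^sup>2)"
      using H minZ design by (intro sum_mono power_mono) (auto simp: H_def v_def)
    also have "\<dots> = real (card ?K) * H\<^sup>2" by simp
    also have "\<dots> \<le> (2 * real n * \<rho> + 1) * H\<^sup>2"
      using n \<rho> by (intro mult_right_mono card_design_points_le) auto
    finally show ?thesis .
  qed
  have "level_set_profile n \<sigma> f H \<rho>"
  proof
    show "\<exists>k\<le>n. \<bar>real k / real n - minimizer f\<bar> \<le> \<rho> \<and> f (real k / real n) \<le> f (minimizer f) + H"
      using k0(1) u(1) in_L[OF design[OF k0(1)]]
      by (intro exI[of _ k0]) (auto simp: v_def H_def Z_def)
  qed (use n \<sigma> f H \<rho> growth noise_le in \<open>auto simp: Z_def\<close>)
  moreover have "ennreal (exp (-9/2) / 3 * \<rho>) \<le> benchmark n \<sigma> f"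
  proof (cases "benchmark n \<sigma> f")
    case (real b)
    let ?c = "exp (-9/2) / 3 :: real"
    have "\<bar>t - Z\<bar> \<le> b / ?c" if "t \<in> L" for t
    proof -
      have "ennreal (?c * \<bar>t - Z\<bar>) \<le> benchmark n \<sigma> f"
        unfolding Z_def using that u n \<sigma> f
        by (intro benchmark_ge_level_set[where u = u]) (auto simp: L_def S_def v_def)
      then have "?c * \<bar>t - Z\<bar> \<le> b" using real by simp
      then show ?thesis by (simp add: field_simps)
    qed
    then have "\<rho> \<le> b / ?c" unfolding \<rho>_def using \<open>Z \<in> L\<close> by (intro cSUP_least) auto
    then show ?thesis using real by (auto simp: field_simps intro!: ennreal_leI)
  qed simp
  ultimately show thesis by (rule that)
qed

subsection \<open>Blocks, localization and stopping levels\<close>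


definition block :: "nat \<Rightarrow> nat \<Rightarrow> int \<Rightarrow> int set" where
  "block n j i = {(i - 1) * 2 ^ (max_level n - j) .. i * 2 ^ (max_level n - j) - 1}"

text \<open>By \<open>valid_block_subset\<close> and \<open>not_valid_block\<close>, this index
  range describes exactly the blocks contained in the sample, hence those with finite sums.\<close>

definition valid :: "nat \<Rightarrow> nat \<Rightarrow> int \<Rightarrow> bool" where
  "valid n j i \<longleftrightarrow> 1 \<le> i \<and> i \<le> int ((n + 1) div 2 ^ (max_level n - j))"

lemma finite_block [simp]: "finite (block n j i)"
  by (simp add: block_def)

lemma card_block [simp]: "card (block n j i) = 2 ^ (max_level n - j)"
  by (simp add: block_def algebra_simps nat_power_eq)

lemma valid_block_subset:
  assumes "valid n j i" shows "block n j i \<subseteq> {0..int n}"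
proof -
  let ?m = "2 ^ (max_level n - j) :: int"
  have "i * ?m \<le> int ((n + 1) div 2 ^ (max_level n - j)) * ?m"
    using assms by (intro mult_right_mono) (auto simp: valid_def)
  also have "\<dots> = int ((n + 1) div 2 ^ (max_level n - j) * 2 ^ (max_level n - j))" by simp
  also have "\<dots> \<le> int (n + 1)" by (intro iffD2[OF of_nat_le_iff] div_times_less_eq_dividend)
  finally have "i * ?m \<le> int n + 1" by simp
  moreover have "0 \<le> (i - 1) * ?m" using assms by (simp add: valid_def)
  ultimately show ?thesis by (auto simp: block_def)
qed

lemma not_valid_block:
  assumes "\<not> valid n j i" shows "\<exists>k\<in>block n j i. k \<notin> {0..int n}"
proof (cases "1 \<le> i")
  case True
  let ?m = "2 ^ (max_level n - j) :: nat"
  have "(n + 1) div ?m < nat i" using assms True by (auto simp: valid_def)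
  then have "n + 1 < nat i * ?m" by (simp add: div_less_iff_less_mult)
  then have "int (n + 1) < int (nat i * ?m)" by (rule iffD2[OF of_nat_less_iff])
  then have "int n + 1 < i * 2 ^ (max_level n - j)" using True by simp
  then show ?thesis
    by (intro bexI[of _ "i * 2 ^ (max_level n - j) - 1"]) (auto simp: block_def algebra_simps)
next
  case False
  then have "(i - 1) * 2 ^ (max_level n - j) < 0" by (simp add: mult_less_0_iff)
  then show ?thesis
    by (intro bexI[of _ "(i - 1) * 2 ^ (max_level n - j)"]) (auto simp: block_def algebra_simps)
qed

lemma block_sum_valid:
  assumes "valid n j i"
  shows "block_sum n (extend_sample n w) j i = ereal (\<Sum>k\<in>block n j i. w (nat k))"
proof -
  have "block_sum n (extend_sample n w) j i = (\<Sum>k\<in>block n j i. ereal (w (nat k)))"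
    unfolding block_sum_def block_def[symmetric]
    using valid_block_subset[OF assms] by (intro sum.cong) (auto simp: extend_sample_def)
  then show ?thesis by simp
qed

lemma block_sum_not_valid:
  assumes "\<not> valid n j i"
  shows "block_sum n (extend_sample n w) j i = \<infinity>"
  using not_valid_block[OF assms]
  unfolding block_sum_def block_def[symmetric] by (auto simp: sum_Pinfty extend_sample_def)

lemma sum_block_shift:
  "(\<Sum>k\<in>block n j b. h k) = (\<Sum>k\<in>block n j a. h (k + (b - a) * 2 ^ (max_level n - j)))"
  unfolding block_def
  by (intro sum.reindex_bij_witness[where i = "\<lambda>k. k + (b - a) * 2 ^ (max_level n - j)"
        and j = "\<lambda>k. k - (b - a) * 2 ^ (max_level n - j)"]) (auto simp: algebra_simps)

lemma max_level_bounds: "2 ^ max_level n \<le> n + 1" "n + 1 < 2 * 2 ^ max_level n"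
proof -
  have J: "real (max_level n) = real_of_int \<lfloor>log 2 (real (n + 1))\<rfloor>"
    by (simp add: max_level_def)
  have "real (max_level n) \<le> log 2 (real (n + 1))" "log 2 (real (n + 1)) < real (max_level n) + 1"
    unfolding J by linarith+
  then have "2 powr real (max_level n) \<le> real (n + 1)" "real (n + 1) < 2 powr (real (max_level n) + 1)"
    by (simp_all add: le_log_iff log_less_iff)
  then have "real (2 ^ max_level n) \<le> real (n + 1)" "real (n + 1) < real (2 * 2 ^ max_level n)"
    by (simp_all add: powr_add powr_realpow)
  then show "2 ^ max_level n \<le> n + 1" "n + 1 < 2 * 2 ^ max_level n"
    unfolding of_nat_le_iff of_nat_less_iff by blast+
qed

text \<open>The search range at level \<open>Suc j\<close>, indexed by its parent level
  \<open>j\<close>.\<close>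

definition candidates :: "nat \<Rightarrow> (int \<Rightarrow> ereal) \<Rightarrow> nat \<Rightarrow> int set" where
  "candidates n l j = {max (2 * loc_index n l j - 2) 1 ..
     min (2 * loc_index n l j + 1) (int ((n + 1) div 2 ^ (max_level n - Suc j)))}"

lemma power_max_level_Suc:
  "Suc j \<le> max_level n \<Longrightarrow> 2 ^ (max_level n - j) = 2 * 2 ^ (max_level n - Suc j)"
  by (metis Suc_diff_Suc Suc_le_lessD power_Suc)

lemma double_div_le: "2 * (a div (2 * m)) \<le> a div (m :: nat)"
  by (metis div_mult2_eq mult.commute times_div_less_eq_dividend)

text \<open>The right child of a block inside the sample is inside the sample too. Only on a
  nonempty range does \<open>arg_min_on\<close> return a member.\<close>

lemma candidates_nonempty:
  assumes "Suc j \<le> max_level n" "valid n j (loc_index n l j)"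
  shows "2 * loc_index n l j \<in> candidates n l j"
proof -
  let ?m = "2 ^ (max_level n - Suc j) :: nat"
  have "loc_index n l j \<le> int ((n + 1) div (2 * ?m))"
    using assms by (simp add: valid_def power_max_level_Suc)
  then have "2 * loc_index n l j \<le> int (2 * ((n + 1) div (2 * ?m)))" by simp
  also have "\<dots> \<le> int ((n + 1) div ?m)" by (intro iffD2[OF of_nat_le_iff] double_div_le)
  finally show ?thesis using assms(2) by (simp add: candidates_def valid_def)
qed

lemma loc_index_Suc: "loc_index n l (Suc j) = arg_min_on (block_sum n l (Suc j)) (candidates n l j)"
  by (simp add: candidates_def)

lemma finite_candidates [simp]: "finite (candidates n l j)"
  by (simp add: candidates_def)

lemma valid_loc_index: "j \<le> max_level n \<Longrightarrow> valid n j (loc_index n l j)"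
proof (induction j)
  case 0
  have "0 < (n + 1) div 2 ^ max_level n"
    using max_level_bounds(1)[of n] by (simp add: div_greater_zero_iff)
  then show ?case by (simp add: valid_def)
next
  case (Suc j)
  have "loc_index n l (Suc j) \<in> candidates n l j"
    using candidates_nonempty[OF Suc.prems Suc.IH] Suc.prems
    unfolding loc_index_Suc by (intro arg_min_if_finite(1)) auto
  then show ?case by (simp add: candidates_def valid_def)
qed

lemma
  assumes "Suc j \<le> max_level n"
  shows loc_index_candidates: "loc_index n l (Suc j) \<in> candidates n l j"
    and loc_index_minimal:
      "\<And>i. i \<in> candidates n l j \<Longrightarrow> block_sum n l (Suc j) (loc_index n l (Suc j)) \<le> block_sum n l (Suc j) i"
proof -
  have *: "2 * loc_index n l j \<in> candidates n l j"
    using assms by (intro candidates_nonempty valid_loc_index) auto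
  show "loc_index n l (Suc j) \<in> candidates n l j"
    using * unfolding loc_index_Suc by (intro arg_min_if_finite(1)) auto
  show "block_sum n l (Suc j) (loc_index n l (Suc j)) \<le> block_sum n l (Suc j) i"
    if "i \<in> candidates n l j" for i
    using that unfolding loc_index_Suc by (intro arg_min_least) auto
qed

section \<open>The stopping level\<close>

definition stops :: "nat \<Rightarrow> real \<Rightarrow> (int \<Rightarrow> ereal) \<Rightarrow> (int \<Rightarrow> ereal) \<Rightarrow> nat \<Rightarrow> bool" where
  "stops n \<sigma> l s j \<longleftrightarrow> stop_stat n l s j \<le> ereal (2 * sigma_tilde n \<sigma> j)"

lemma hat_level_le: "hat_level n \<sigma> l s \<le> max_level n"
proof -
  have "min (enat (max_level n)) (check_level n \<sigma> l s) \<le> enat (max_level n)" by simp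
  then obtain i where "min (enat (max_level n)) (check_level n \<sigma> l s) = enat i" "i \<le> max_level n"
    by (metis enat_ile enat_ord_simps(1))
  then show ?thesis by (simp add: hat_level_def)
qed

lemma le_hat_level:
  assumes "\<tau> \<le> max_level n" "\<And>j. j < \<tau> \<Longrightarrow> \<not> stops n \<sigma> l s j"
  shows "\<tau> \<le> hat_level n \<sigma> l s"
proof -
  have "enat \<tau> \<le> check_level n \<sigma> l s"
    unfolding check_level_def using assms(2)
    by (intro INF_greatest) (auto simp: stops_def not_less[symmetric])
  then have "enat \<tau> \<le> min (enat (max_level n)) (check_level n \<sigma> l s)" using assms(1) by simp
  moreover obtain i where "min (enat (max_level n)) (check_level n \<sigma> l s) = enat i"
    by (metis enat_ile min.cobounded1)
  ultimately show ?thesis by (simp add: hat_level_def)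
qed

lemma check_level_infinity:
  assumes "\<not> check_level n \<sigma> l s < \<infinity>"
  shows "hat_level n \<sigma> l s = max_level n"
  using assms by (simp add: hat_level_def)

lemma check_level_eq_infinity:
  assumes "\<And>j. j \<le> max_level n \<Longrightarrow> \<not> stops n \<sigma> l s j"
  shows "\<not> check_level n \<sigma> l s < \<infinity>"
proof -
  have "{j. j \<le> max_level n \<and> stop_stat n l s j \<le> ereal (2 * sigma_tilde n \<sigma> j)} = {}"
    using assms by (auto simp: stops_def)
  then show ?thesis unfolding check_level_def by (simp only: image_empty Inf_empty top_enat_def)
qed

text \<open>Index of the first design point of the selected block, real-valued for comparison with
  \<open>real n * minimizer f\<close>.\<close>

definition block_start :: "nat \<Rightarrow> (int \<Rightarrow> ereal) \<Rightarrow> nat \<Rightarrow> real" where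
  "block_start n l j = (real_of_int (loc_index n l j) - 1) * 2 ^ (max_level n - j)"

text \<open>One refinement moves the start by at most two child blocks. As block lengths halve, this
  is twice the parent length minus twice the child length, and the moves telescope.\<close>

lemma block_start_drift:
  assumes "\<tau> \<le> j" "j \<le> max_level n"
  shows "\<bar>block_start n l j - block_start n l \<tau>\<bar> \<le> 2 * 2 ^ (max_level n - \<tau>) - 2 * 2 ^ (max_level n - j)"
  using assms
proof (induction j rule: dec_induct)
  case base
  then show ?case by simp
next
  case (step j)
  let ?i = "real_of_int (loc_index n l j)" and ?i' = "real_of_int (loc_index n l (Suc j))"
  let ?m = "2 ^ (max_level n - Suc j) :: real"
  have "2 * loc_index n l j - 2 \<le> loc_index n l (Suc j)" "loc_index n l (Suc j) \<le> 2 * loc_index n l j + 1"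
    using loc_index_candidates[of j n l] step.prems by (auto simp: candidates_def)
  then have "-1 \<le> ?i' - 2 * ?i + 1" "?i' - 2 * ?i + 1 \<le> 2" by linarith+
  then have "-1 * ?m \<le> (?i' - 2 * ?i + 1) * ?m" "(?i' - 2 * ?i + 1) * ?m \<le> 2 * ?m"
    by (intro mult_right_mono; simp)+
  moreover have "block_start n l (Suc j) - block_start n l j = (?i' - 2 * ?i + 1) * ?m"
    using step.prems by (simp add: block_start_def power_max_level_Suc algebra_simps)
  moreover have "(2::real) ^ (max_level n - j) = 2 * ?m"
    using step.prems by (simp add: power_max_level_Suc)
  moreover have "0 < ?m" by simp
  ultimately show ?case using step.IH step.prems by linarith
qed

subsection \<open>Separation of block means\<close>


context level_set_profile
begin

abbreviation Z :: real where "Z \<equiv> minimizer f"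

abbreviation m :: "nat \<Rightarrow> real" where "m j \<equiv> 2 ^ (max_level n - j)"

text \<open>Index, counted from 1, of the block whose half-open range contains
  \<open>real n * Z\<close>. It may be one past the last complete block, as \<open>iZ_le\<close>
  allows.\<close>

definition iZ :: "nat \<Rightarrow> int" where "iZ j = \<lfloor>real n * Z / m j\<rfloor> + 1"

definition mean :: "int \<Rightarrow> real" where "mean k = f (real_of_int k / real n)"

text \<open>Moving one block outward at slope \<open>H / \<rho>\<close> raises each of the
  \<open>m j\<close> means of a block by \<open>m j * H / (real n * \<rho>)\<close>.\<close>

definition gap :: "nat \<Rightarrow> real" where "gap j = (m j)\<^sup>2 * H / (real n * \<rho>)"

definition block_noise :: "(nat \<Rightarrow> real) \<Rightarrow> nat \<Rightarrow> int \<Rightarrow> real" where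
  "block_noise w j i = (\<Sum>k\<in>block n j i. w (nat k) - mean k)"

text \<open>The radius 7 combines a location error of 1 with the offset 6 of the stopping
  rule.\<close>

definition near_blocks :: "nat \<Rightarrow> int set" where
  "near_blocks j = {i\<in>{iZ j - 7..iZ j + 7}. valid n j i}"

text \<open>A sum over fixed blocks dominates the squared noise of whichever nearby pair the
  procedure compares, so no data-dependent index has to be integrated.\<close>

definition noise_energy :: "(nat \<Rightarrow> real) \<Rightarrow> nat \<Rightarrow> real" where
  "noise_energy w j = (\<Sum>i\<in>near_blocks j. (block_noise w j i)\<^sup>2)"

lemma Z_bounds: "0 \<le> Z" "Z \<le> 1"
  using minimizer_in_unit_interval[OF f] by auto

lemma finite_near_blocks [simp]: "finite (near_blocks j)"
  by (rule finite_subset[of _ "{iZ j - 7..iZ j + 7}"]) (auto simp: near_blocks_def)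

lemma noise_energy_nonneg: "0 \<le> noise_energy w j"
  by (simp add: noise_energy_def sum_nonneg)

lemma gap_pos: "0 < gap j"
  using n H \<rho> by (simp add: gap_def)

lemma iZ_bounds: "(real_of_int (iZ j) - 1) * m j \<le> real n * Z" "real n * Z < real_of_int (iZ j) * m j"
proof -
  show "(real_of_int (iZ j) - 1) * m j \<le> real n * Z"
    by (subst pos_le_divide_eq[symmetric]) (simp_all add: iZ_def)
  show "real n * Z < real_of_int (iZ j) * m j"
    by (subst pos_divide_less_eq[symmetric]) (simp_all add: iZ_def)
qed

lemma iZ_ge_1: "1 \<le> iZ j"
  using Z_bounds by (simp add: iZ_def)

lemma iZ_le: "iZ j \<le> int ((n + 1) div 2 ^ (max_level n - j)) + 1"
proof -
  let ?m = "2 ^ (max_level n - j) :: nat"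
  have "real n * Z / m j \<le> real (n + 1) / real ?m"
    using Z_bounds mult_left_le[of Z "real n"] by (simp add: divide_right_mono)
  then have "\<lfloor>real n * Z / m j\<rfloor> \<le> \<lfloor>real (n + 1) / real ?m\<rfloor>" by (rule floor_mono)
  also have "\<dots> = int ((n + 1) div ?m)" by (rule floor_divide_of_nat_eq)
  finally show ?thesis by (simp add: iZ_def)
qed

text \<open>The finer block containing \<open>real n * Z\<close> is one of the two children of the
  coarser one.\<close>

lemma iZ_Suc:
  assumes "Suc j \<le> max_level n"
  shows "2 * iZ j - 1 \<le> iZ (Suc j)" "iZ (Suc j) \<le> 2 * iZ j"
proof -
  have mj: "m j = 2 * m (Suc j)" using assms by (rule power_max_level_Suc)
  have "(2 * (real_of_int (iZ j) - 1)) * m (Suc j) < real_of_int (iZ (Suc j)) * m (Suc j)"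
    using iZ_bounds(1)[of j] iZ_bounds(2)[of "Suc j"] unfolding mj by (simp only: mult_ac)
  then have "2 * (real_of_int (iZ j) - 1) < real_of_int (iZ (Suc j))" by (rule mult_right_less_imp_less) simp
  then have "real_of_int (2 * iZ j - 2) < real_of_int (iZ (Suc j))" by simp
  then show "2 * iZ j - 1 \<le> iZ (Suc j)" unfolding of_int_less_iff by linarith
  have "(real_of_int (iZ (Suc j)) - 1) * m (Suc j) < (2 * real_of_int (iZ j)) * m (Suc j)"
    using iZ_bounds(2)[of j] iZ_bounds(1)[of "Suc j"] unfolding mj by (simp only: mult_ac)
  then have "real_of_int (iZ (Suc j)) - 1 < 2 * real_of_int (iZ j)" by (rule mult_right_less_imp_less) simp
  then show "iZ (Suc j) \<le> 2 * iZ j" by linarith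
qed

text \<open>By convexity the steepness between \<open>s\<close> and \<open>t\<close> is at least
  that between \<open>Z\<close> and \<open>t\<close>, which \<open>growth\<close> bounds below by
  \<open>H / \<rho>\<close>.\<close>

lemma slope:
  assumes s: "s \<in> {0..1}" and t: "t \<in> {0..1}" "\<rho> < \<bar>t - Z\<bar>"
    and order: "Z \<le> s \<and> s \<le> t \<or> t \<le> s \<and> s \<le> Z"
  shows "\<bar>t - s\<bar> * H \<le> (f t - f s) * \<rho>"
proof -
  have tZ: "0 < \<bar>t - Z\<bar>" using t \<rho> by simp
  define c where "c = \<bar>s - Z\<bar> / \<bar>t - Z\<bar>"
  have c: "0 \<le> c" "c \<le> 1" using order tZ by (auto simp: c_def divide_le_eq_1)
  have s_eq: "Z + c * (t - Z) = s" using order tZ by (auto simp: c_def field_simps abs_if split: if_splits)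
  have "f s \<le> f Z + c * (f t - f Z)"
    using convex_class_segment(2)[OF f t(1) c] unfolding s_eq .
  then have "(1 - c) * (f t - f Z) \<le> f t - f s" by (simp add: algebra_simps)
  then have "(1 - c) * ((f t - f Z) * \<rho>) \<le> (f t - f s) * \<rho>"
    using \<rho> by (metis mult.assoc mult_right_mono less_imp_le)
  moreover have "(1 - c) * (H * \<bar>t - Z\<bar>) \<le> (1 - c) * ((f t - f Z) * \<rho>)"
    using c growth[OF t] by (intro mult_left_mono) auto
  moreover have "(1 - c) * (H * \<bar>t - Z\<bar>) = \<bar>t - s\<bar> * H"
  proof -
    have "(1 - c) * \<bar>t - Z\<bar> = \<bar>t - s\<bar>"
      using order tZ by (auto simp: c_def field_simps abs_if split: if_splits)
    then show ?thesis by (metis mult.assoc mult.commute)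
  qed
  ultimately show ?thesis by linarith
qed

text \<open>Block \<open>a\<close> lies on one side of the minimizer and \<open>b\<close> farther
  out. Each point of \<open>a\<close> is matched with its translate in \<open>b\<close>, and
  \<open>slope\<close> is summed over the block.\<close>

lemma gap_le_block_mean_diff:
  assumes va: "valid n j a" and vb: "valid n j b" and large: "real n * \<rho> < m j"
    and order: "iZ j + 1 \<le> a \<and> a < b \<or> b < a \<and> a \<le> iZ j - 1"
  shows "gap j \<le> (\<Sum>k\<in>block n j b. mean k) - (\<Sum>k\<in>block n j a. mean k)"
proof -
  let ?M = "2 ^ (max_level n - j) :: int"
  let ?h = "(b - a) * ?M"
  have M: "real_of_int ?M = m j" by simp
  have step: "m j * H / (real n * \<rho>) \<le> mean (k + ?h) - mean k" if k: "k \<in> block n j a" for k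
  proof -
    define s where "s = real_of_int k / real n"
    define t where "t = real_of_int (k + ?h) / real n"
    have "k + ?h \<in> block n j b" using k by (auto simp: block_def algebra_simps)
    then have "k \<in> {0..int n}" "k + ?h \<in> {0..int n}"
      using k valid_block_subset[OF va] valid_block_subset[OF vb] by auto
    then have st: "s \<in> {0..1}" "t \<in> {0..1}"
      using n by (auto simp: s_def t_def divide_le_eq_1 simp del: of_int_add of_int_mult)
    have ts: "real n * (t - s) = real_of_int (b - a) * m j"
      using n by (simp add: s_def t_def field_simps)
    have d: "m j \<le> real n * \<bar>t - s\<bar>"
    proof -
      have "1 * m j \<le> \<bar>real_of_int (b - a)\<bar> * m j"
        using order by (intro mult_right_mono) auto
      also have "\<dots> = real n * \<bar>t - s\<bar>"
        using arg_cong[OF ts, of abs] by (simp add: abs_mult)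
      finally show ?thesis by simp
    qed
    have sZ: "Z \<le> s \<and> s \<le> t \<or> t \<le> s \<and> s \<le> Z"
      using order
    proof (elim disjE conjE)
      assume *: "iZ j + 1 \<le> a" "a < b"
      have "iZ j * ?M \<le> (a - 1) * ?M" using * by (intro mult_right_mono) auto
      also have "\<dots> \<le> k" using k by (simp add: block_def)
      finally have "real_of_int (iZ j * ?M) \<le> real_of_int k" by (rule iffD2[OF of_int_le_iff])
      then have "real n * Z \<le> real_of_int k" using iZ_bounds(2)[of j] by simp
      then have "Z \<le> s" using n by (simp add: s_def field_simps)
      moreover have "0 \<le> real n * (t - s)" unfolding ts using * by simp
      ultimately show ?thesis using n by (simp add: zero_le_mult_iff)
    next
      assume *: "b < a" "a \<le> iZ j - 1"
      have "k \<le> a * ?M" using k by (simp add: block_def)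
      also have "\<dots> \<le> (iZ j - 1) * ?M" using * by (intro mult_right_mono) auto
      finally have "real_of_int k \<le> real_of_int ((iZ j - 1) * ?M)" by (rule iffD2[OF of_int_le_iff])
      then have "real_of_int k \<le> real n * Z" using iZ_bounds(1)[of j] by simp
      then have "s \<le> Z" using n by (simp add: s_def field_simps)
      moreover have "real n * (t - s) \<le> 0" unfolding ts using * by (simp add: mult_le_0_iff)
      ultimately show ?thesis using n by (simp add: mult_le_0_iff)
    qed
    \<comment> \<open>The outer point is at least as far from \<open>Z\<close> as from
      \<open>s\<close>, and one block length exceeds \<open>real n * \<rho>\<close>.\<close>
    have "\<rho> < \<bar>t - Z\<bar>"
    proof -
      have "real n * \<rho> < real n * \<bar>t - s\<bar>" using large d by linarith
      then have "\<rho> < \<bar>t - s\<bar>" using n by (simp add: mult_less_cancel_left_pos)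
      then show ?thesis using sZ by auto
    qed
    from slope[OF st this sZ] have "real n * (\<bar>t - s\<bar> * H) \<le> real n * ((f t - f s) * \<rho>)"
      using n by (intro mult_left_mono) auto
    moreover have "m j * H \<le> real n * \<bar>t - s\<bar> * H" using d H by (intro mult_right_mono) auto
    ultimately have "m j * H \<le> (f t - f s) * (real n * \<rho>)" by (simp add: algebra_simps)
    then show ?thesis
      using n \<rho> by (simp add: mean_def s_def t_def pos_divide_le_eq)
  qed
  have "gap j = (\<Sum>k\<in>block n j a. m j * H / (real n * \<rho>))"
    by (simp add: gap_def power2_eq_square)
  also have "\<dots> \<le> (\<Sum>k\<in>block n j a. mean (k + ?h) - mean k)"
    by (intro sum_mono step)
  also have "\<dots> = (\<Sum>k\<in>block n j b. mean k) - (\<Sum>k\<in>block n j a. mean k)"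
    by (simp only: sum_subtractf sum_block_shift[of mean n j b a])
  finally show ?thesis .
qed

text \<open>A wrong comparison of two blocks on the same side of the minimizer forces the noise to
  exceed the gap of the means.\<close>

lemma gap_le_noise:
  assumes v: "valid n j a" "valid n j b" and large: "real n * \<rho> < m j"
    and order: "iZ j + 1 \<le> a \<and> a < b \<or> b < a \<and> a \<le> iZ j - 1"
    and near: "\<bar>b - iZ j\<bar> \<le> 7"
    and c: "c \<le> 2 * sigma_tilde n \<sigma> j"
    and le: "(\<Sum>k\<in>block n j b. w (nat k)) - (\<Sum>k\<in>block n j a. w (nat k)) \<le> c"
  shows "(gap j)\<^sup>2 \<le> 8 * noise_energy w j + 96 * m j * \<sigma>\<^sup>2"
proof -
  define A B where "A = block_noise w j a" and "B = block_noise w j b"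
  have st: "(sigma_tilde n \<sigma> j)\<^sup>2 = 6 * m j * \<sigma>\<^sup>2" "0 \<le> sigma_tilde n \<sigma> j"
    by (simp_all add: sigma_tilde_def)
  have "gap j \<le> A - B + 2 * sigma_tilde n \<sigma> j"
    using gap_le_block_mean_diff[OF v large order] le c
    by (simp add: A_def B_def block_noise_def sum_subtractf)
  \<comment> \<open>Either the noise or the threshold accounts for at least half of the gap.\<close>
  then have "gap j \<le> 2 * A - 2 * B \<or> gap j \<le> 4 * sigma_tilde n \<sigma> j" by linarith
  then show ?thesis
  proof
    assume "gap j \<le> 2 * A - 2 * B"
    then have "(gap j)\<^sup>2 \<le> (2 * A - 2 * B)\<^sup>2" using gap_pos[of j] by (intro power_mono) auto
    also have "\<dots> \<le> 8 * (A\<^sup>2 + B\<^sup>2)"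
      using zero_le_power2[of "A + B"] by (simp add: power2_eq_square algebra_simps)
    also have "A\<^sup>2 + B\<^sup>2 = (\<Sum>i\<in>{a, b}. (block_noise w j i)\<^sup>2)"
      using order by (auto simp: A_def B_def)
    also have "\<dots> \<le> noise_energy w j"
      unfolding noise_energy_def using v order near by (intro sum_mono2 finite_near_blocks) (auto simp: near_blocks_def)
    finally have "(gap j)\<^sup>2 \<le> 8 * noise_energy w j" by simp
    moreover have "0 \<le> 96 * m j * \<sigma>\<^sup>2" by simp
    ultimately show ?thesis by linarith
  next
    assume "gap j \<le> 4 * sigma_tilde n \<sigma> j"
    then have "(gap j)\<^sup>2 \<le> (4 * sigma_tilde n \<sigma> j)\<^sup>2" using gap_pos[of j] by (intro power_mono) auto
    also have "\<dots> = 96 * m j * \<sigma>\<^sup>2" by (simp add: power_mult_distrib st)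
    finally show ?thesis using noise_energy_nonneg[of w j] by simp
  qed
qed

text \<open>An offset of 1 is tolerated because \<open>gap_le_block_mean_diff\<close> only compares
  blocks strictly on one side of the block containing the minimizer.\<close>

definition located :: "(int \<Rightarrow> ereal) \<Rightarrow> nat \<Rightarrow> bool" where
  "located l j \<longleftrightarrow> \<bar>loc_index n l j - iZ j\<bar> \<le> 1"

text \<open>The level-0 block has more than half of the \<open>n + 1\<close> design points, so
  \<open>iZ 0\<close> is 1 or 2.\<close>

lemma located_0: "located l 0"
proof -
  have "real n * Z \<le> real n" using Z_bounds by (simp add: mult_left_le)
  also have "\<dots> < real (2 * 2 ^ max_level n)"
    using max_level_bounds(2)[of n] by (intro iffD2[OF of_nat_less_iff]) simp
  finally have "real n * Z < 2 * m 0" by simp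
  with iZ_bounds(1)[of 0] have "(real_of_int (iZ 0) - 1) * m 0 < 2 * m 0" by (rule le_less_trans)
  then have "real_of_int (iZ 0) - 1 < 2" by (rule mult_right_less_imp_less) simp
  then show ?thesis using iZ_ge_1[of 0] unfolding located_def loc_index.simps by linarith
qed

text \<open>A selected block at distance at least 2 from \<open>iZ (Suc j)\<close> has beaten the
  neighbour of \<open>iZ (Suc j)\<close> on its own side, although that neighbour has the smaller
  mean.\<close>

lemma not_located_Suc:
  assumes J: "Suc j \<le> max_level n" and large: "real n * \<rho> < m (Suc j)"
    and loc: "located (extend_sample n w) j" "\<not> located (extend_sample n w) (Suc j)"
  shows "(gap (Suc j))\<^sup>2 \<le> 8 * noise_energy w (Suc j) + 96 * m (Suc j) * \<sigma>\<^sup>2"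
proof -
  let ?l = "extend_sample n w"
  define i where "i = loc_index n ?l j"
  define b where "b = loc_index n ?l (Suc j)"
  let ?N = "int ((n + 1) div 2 ^ (max_level n - Suc j))"
  have b: "max (2 * i - 2) 1 \<le> b" "b \<le> min (2 * i + 1) ?N"
    using loc_index_candidates[OF J, of ?l] by (auto simp: candidates_def i_def b_def)
  have i: "\<bar>i - iZ j\<bar> \<le> 1" and bZ: "\<not> \<bar>b - iZ (Suc j)\<bar> \<le> 1"
    using loc by (auto simp: located_def i_def b_def)
  note Z1 = iZ_Suc[OF J] and Z2 = iZ_ge_1[of "Suc j"] and Z3 = iZ_le[of "Suc j"]
  \<comment> \<open>This neighbour is itself a candidate: on one side \<open>b\<close> bounds it, on
    the other \<open>iZ_Suc\<close> and \<open>iZ_le\<close> keep it in the search range.\<close>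
  define a where "a = (if iZ (Suc j) < b then iZ (Suc j) + 1 else iZ (Suc j) - 1)"
  have a: "max (2 * i - 2) 1 \<le> a" "a \<le> min (2 * i + 1) ?N"
    using b i bZ Z1 Z2 Z3 unfolding a_def by (auto split: if_splits)
  have order: "iZ (Suc j) + 1 \<le> a \<and> a < b \<or> b < a \<and> a \<le> iZ (Suc j) - 1"
    using bZ unfolding a_def by auto
  have near: "\<bar>b - iZ (Suc j)\<bar> \<le> 7" using b i Z1 by linarith
  have v: "valid n (Suc j) a" "valid n (Suc j) b"
    using a b by (auto simp: valid_def)
  have "block_sum n ?l (Suc j) b \<le> block_sum n ?l (Suc j) a"
    unfolding b_def by (rule loc_index_minimal[OF J]) (use a in \<open>auto simp: candidates_def i_def\<close>)
  then have "(\<Sum>k\<in>block n (Suc j) b. w (nat k)) - (\<Sum>k\<in>block n (Suc j) a. w (nat k)) \<le> 0"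
    using v by (simp add: block_sum_valid)
  then show ?thesis
    using v large order near by (intro gap_le_noise[where c = 0]) (auto simp: sigma_tilde_def)
qed

text \<open>With a location error of at most 1, both blocks in either difference of the stopping
  rule lie on the same side of the minimizer, where the outer mean exceeds the inner one by
  \<open>gap j\<close>.\<close>

lemma located_stops:
  assumes large: "real n * \<rho> < m j" and loc: "located l j"
    and stop: "stops n \<sigma> l (extend_sample n w) j"
  shows "(gap j)\<^sup>2 \<le> 8 * noise_energy w j + 96 * m j * \<sigma>\<^sup>2"
proof -
  let ?s = "extend_sample n w"
  define i where "i = loc_index n l j"
  have i: "\<bar>i - iZ j\<bar> \<le> 1" using loc by (simp add: located_def i_def)
  have main: ?thesis
    if stop: "block_sum n ?s j b - block_sum n ?s j a \<le> ereal (2 * sigma_tilde n \<sigma> j)"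
      and order: "iZ j + 1 \<le> a \<and> a < b \<or> b < a \<and> a \<le> iZ j - 1"
      and near: "\<bar>b - iZ j\<bar> \<le> 7" and va: "valid n j b \<Longrightarrow> valid n j a" for a b
  proof -
    \<comment> \<open>An outer block that leaves the sample makes the difference
      \<open>\<infinity>\<close>, which never meets the threshold.\<close>
    have vb: "valid n j b"
    proof (rule ccontr)
      assume "\<not> valid n j b"
      then have "block_sum n ?s j b = \<infinity>" by (rule block_sum_not_valid)
      then show False using stop by simp
    qed
    show ?thesis
      using stop order near vb va[OF vb] large
      by (intro gap_le_noise[where a = a and b = b and c = "2 * sigma_tilde n \<sigma> j"])
         (auto simp: block_sum_valid)
  qed
  have v: "1 \<le> iZ j" "iZ j \<le> int ((n + 1) div 2 ^ (max_level n - j)) + 1" by (rule iZ_ge_1 iZ_le)+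
  from stop consider
      "block_sum n ?s j (i + 6) - block_sum n ?s j (i + 5) \<le> ereal (2 * sigma_tilde n \<sigma> j)"
    | "block_sum n ?s j (i - 6) - block_sum n ?s j (i - 5) \<le> ereal (2 * sigma_tilde n \<sigma> j)"
    by (auto simp: stops_def stop_stat_def Let_def i_def min_le_iff_disj)
  then show ?thesis
  proof cases
    case 1
    show ?thesis by (rule main[OF 1]) (use i v in \<open>auto simp: valid_def\<close>)
  next
    case 2
    show ?thesis by (rule main[OF 2]) (use i v in \<open>auto simp: valid_def\<close>)
  qed
qed

end

subsection \<open>A pointwise bound on the error\<close>


context level_set_profile
begin

text \<open>Four distances add up: from the estimate to the start of the final block, the drift
  after level \<open>\<tau>\<close>, the location error at \<open>\<tau>\<close>, and the position
  of the minimizer in its block.\<close>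

lemma error_located:
  fixes y z1 z2
  defines "l \<equiv> sample_l n \<sigma> y z1 z2" and "s \<equiv> sample_s n \<sigma> y z1 z2"
  assumes \<tau>: "\<tau> \<le> hat_level n \<sigma> l s" and loc: "located l \<tau>"
  shows "real n * \<bar>Z_hat n \<sigma> y z1 z2 - Z\<bar> \<le> 6 * m \<tau>"
proof -
  define h where "h = hat_level n \<sigma> l s"
  define i where "i = loc_index n l h"
  have h: "\<tau> \<le> h" "h \<le> max_level n" using \<tau> hat_level_le by (auto simp: h_def)
  \<comment> \<open>The first form of the estimator is \<open>m h / 2 - 1 / 2\<close> past the block
    start. The second occurs only at the finest level, where \<open>m h = 1\<close> and its index
    differs from \<open>i\<close> by at most 2.\<close>
  have center: "\<bar>real n * Z_hat n \<sigma> y z1 z2 - block_start n l h\<bar> \<le> 2 * m h"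
  proof (cases "check_level n \<sigma> l s < \<infinity>")
    case True
    have "(2::real) powi (int (max_level n) - int h - 1) = 2 powi int (max_level n - h) / 2 powi 1"
      unfolding of_nat_diff[OF h(2)] by (rule power_int_diff) simp
    then have "(2::real) powi (int (max_level n) - int h - 1) = m h / 2"
      by (simp only: power_int_of_nat power_int_1_right)
    then have "Z_hat n \<sigma> y z1 z2 = - 1 / (2 * real n) + 1 / real n * (m h * real_of_int i - m h / 2)"
      using True unfolding Z_hat_def Let_def l_def[symmetric] s_def[symmetric] h_def[symmetric] i_def[symmetric]
      by simp
    moreover have "c * (- 1 / (2 * c) + 1 / c * x) = - (1 / 2) + x" if "c \<noteq> 0" for c x :: real
      using that by (simp add: field_simps)
    ultimately have "real n * Z_hat n \<sigma> y z1 z2 = - (1 / 2) + (m h * real_of_int i - m h / 2)"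
      using n by simp
    then have "real n * Z_hat n \<sigma> y z1 z2 - block_start n l h = m h / 2 - 1 / 2"
      by (simp add: block_start_def i_def algebra_simps)
    moreover have "1 \<le> m h" by simp
    ultimately show ?thesis by linarith
  next
    case False
    have hJ: "h = max_level n" using check_level_infinity[OF False] by (simp add: h_def)
    define a where "a = arg_min_on (\<lambda>k. sample_e n \<sigma> y z1 (k - 1)) {i - 2..i + 2}"
    have "a \<in> {i - 2..i + 2}" unfolding a_def by (intro arg_min_if_finite(1)) auto
    then have "\<bar>real_of_int a - real_of_int i\<bar> \<le> 2" by auto
    moreover have "Z_hat n \<sigma> y z1 z2 = 1 / real n * real_of_int a - 1 / real n"
      using False unfolding Z_hat_def Let_def l_def[symmetric] s_def[symmetric] h_def[symmetric] i_def[symmetric] a_def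
      by simp
    then have "real n * Z_hat n \<sigma> y z1 z2 = real_of_int a - 1"
      using n by (simp add: field_simps)
    ultimately show ?thesis by (simp add: block_start_def hJ i_def[unfolded hJ])
  qed
  have drift: "\<bar>block_start n l h - block_start n l \<tau>\<bar> \<le> 2 * m \<tau> - 2 * m h"
    using h by (rule block_start_drift)
  have "\<bar>block_start n l \<tau> - (real_of_int (iZ \<tau>) - 1) * m \<tau>\<bar> \<le> m \<tau>"
  proof -
    have "block_start n l \<tau> - (real_of_int (iZ \<tau>) - 1) * m \<tau> = real_of_int (loc_index n l \<tau> - iZ \<tau>) * m \<tau>"
      by (simp add: block_start_def algebra_simps)
    moreover have "\<bar>real_of_int (loc_index n l \<tau> - iZ \<tau>)\<bar> * m \<tau> \<le> 1 * m \<tau>"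
      using loc by (intro mult_right_mono) (auto simp: located_def)
    ultimately show ?thesis by (simp add: abs_mult)
  qed
  moreover have "real_of_int (iZ \<tau>) * m \<tau> = (real_of_int (iZ \<tau>) - 1) * m \<tau> + m \<tau>"
    by (simp add: algebra_simps)
  ultimately have "\<bar>real n * Z_hat n \<sigma> y z1 z2 - real n * Z\<bar> \<le> 6 * m \<tau>"
    using center drift iZ_bounds[of \<tau>] by linarith
  then show ?thesis using n by (simp add: abs_mult_pos' right_diff_distrib)
qed

text \<open>The counterpart of \<open>noise_energy\<close> for the final minimization. If the finest
  block is located, radius 5 covers every design point that can be selected.\<close>

definition point_energy :: "(nat \<Rightarrow> real) \<Rightarrow> real" where
  "point_energy w = (\<Sum>k\<in>{k\<in>{0..n}. \<bar>real k - real n * Z\<bar> \<le> 5}. (w k - mean (int k))\<^sup>2)"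

lemma point_energy_nonneg: "0 \<le> point_energy w"
  by (simp add: point_energy_def sum_nonneg)

text \<open>The design point supplied by \<open>near\<close> competes in the final minimization, so
  the selected point has no larger noisy value. If the latter is beyond \<open>2 * \<rho>\<close>,
  growth makes its true value larger, and noise must account for the difference.\<close>

lemma error_final:
  fixes y z1 z2
  defines "l \<equiv> sample_l n \<sigma> y z1 z2" and "s \<equiv> sample_s n \<sigma> y z1 z2"
    and "w \<equiv> \<lambda>i. y i - sqrt 2 * \<sigma> * z1 i"
  assumes small: "real n * \<rho> < 1" and loc: "located l (max_level n)"
    and inf: "\<not> check_level n \<sigma> l s < \<infinity>"
  shows "real n * \<bar>Z_hat n \<sigma> y z1 z2 - Z\<bar> \<le> 2 * real n * \<rho> + 4 * real n * \<rho> * point_energy w / H\<^sup>2"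
proof -
  let ?e = "extend_sample n w"
  define i where "i = loc_index n l (max_level n)"
  define a where "a = arg_min_on (\<lambda>k. ?e (k - 1)) {i - 2..i + 2}"
  have Zhat: "Z_hat n \<sigma> y z1 z2 = 1 / real n * real_of_int a - 1 / real n"
    using inf check_level_infinity[OF inf]
    unfolding Z_hat_def Let_def l_def[symmetric] s_def[symmetric] i_def a_def sample_e_def w_def by simp
  obtain k1 where k1: "k1 \<le> n" "\<bar>real k1 / real n - Z\<bar> \<le> \<rho>" "f (real k1 / real n) \<le> f Z + H"
    using near by blast
  have fl: "real_of_int (iZ (max_level n)) - 1 \<le> real n * Z" "real n * Z < real_of_int (iZ (max_level n))"
    using iZ_bounds[of "max_level n"] by simp_all
  have i: "\<bar>i - iZ (max_level n)\<bar> \<le> 1" using loc by (simp add: located_def i_def)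
  have "real n * \<bar>real k1 / real n - Z\<bar> \<le> real n * \<rho>" using k1 by (intro mult_left_mono) auto
  then have k1Z: "\<bar>real k1 - real n * Z\<bar> < 1"
    using n small by (simp add: abs_mult_pos' right_diff_distrib)
  have "real_of_int (int k1) < real_of_int (iZ (max_level n) + 1)"
    "real_of_int (iZ (max_level n) - 2) < real_of_int (int k1)"
    using k1Z fl by auto
  then have "int k1 < iZ (max_level n) + 1" "iZ (max_level n) - 2 < int k1"
    unfolding of_int_less_iff by auto
  \<comment> \<open>Block indices start at 1 and design indices at 0, hence the shift.\<close>
  then have k1_cand: "int k1 + 1 \<in> {i - 2..i + 2}" using i by auto
  have a_in: "a \<in> {i - 2..i + 2}" unfolding a_def by (intro arg_min_if_finite(1)) auto
  have a_min: "?e (a - 1) \<le> ?e (int k1 + 1 - 1)"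
    unfolding a_def using k1_cand by (intro arg_min_least[where f = "\<lambda>k. ?e (k - 1)"]) auto
  \<comment> \<open>The selected value is at most a finite one, so the infinite values outside the
    sample are never selected.\<close>
  have a_range: "a - 1 \<in> {0..int n}"
    using a_min k1(1) by (auto simp: extend_sample_def split: if_splits)
  define K where "K = nat (a - 1)"
  have K: "K \<le> n" "real_of_int a - 1 = real K" "int K = a - 1" using a_range by (auto simp: K_def)
  define x where "x = real K / real n"
  have Zx: "Z_hat n \<sigma> y z1 z2 = x" using K(2) by (simp add: Zhat x_def flip: diff_divide_distrib)
  have wK: "w K \<le> w k1" using a_min a_range k1(1) by (simp add: extend_sample_def K_def)
  have KZ: "\<bar>real K - real n * Z\<bar> \<le> 5"
  proof -
    have "\<bar>a - iZ (max_level n)\<bar> \<le> 3" using a_in i by auto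
    then have "\<bar>real_of_int a - real_of_int (iZ (max_level n))\<bar> \<le> 3" by linarith
    then show ?thesis using fl K(2) by linarith
  qed
  show ?thesis
  proof (cases "\<bar>x - Z\<bar> \<le> 2 * \<rho>")
    case True
    then have "real n * \<bar>x - Z\<bar> \<le> real n * (2 * \<rho>)" by (intro mult_left_mono) auto
    moreover have "0 \<le> 4 * real n * \<rho> * point_energy w / H\<^sup>2" using \<rho> point_energy_nonneg by simp
    ultimately show ?thesis unfolding Zx by linarith
  next
    case False
    have "H * \<bar>x - Z\<bar> \<le> (f x - f Z) * \<rho>"
      using False \<rho> K(1) n by (intro growth) (auto simp: x_def)
    moreover define g where "g = f x - f (real k1 / real n)"
    moreover have "(f x - f Z) * \<rho> \<le> (g + H) * \<rho>"
      using k1(3) \<rho> by (intro mult_right_mono) (auto simp: g_def)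
    moreover have "H * (2 * \<rho>) \<le> H * \<bar>x - Z\<bar>" using False H by (intro mult_left_mono) auto
    \<comment> \<open>Beyond \<open>2 * \<rho>\<close> the term \<open>H * \<rho>\<close> is at most
      half of the left side and is absorbed.\<close>
    ultimately have gH: "H * \<bar>x - Z\<bar> \<le> 2 * \<rho> * g" by (simp add: algebra_simps)
    have "0 < H * \<bar>x - Z\<bar>" using False \<rho> H by simp
    then have "0 < 2 * \<rho> * g" using gH by linarith
    then have g: "0 < g" using \<rho> by (simp add: zero_less_mult_iff)
    have "g \<le> (w k1 - mean (int k1)) - (w K - mean (int K))"
      using wK by (simp add: g_def mean_def x_def)
    then have "g\<^sup>2 \<le> ((w k1 - mean (int k1)) - (w K - mean (int K)))\<^sup>2"
      using g by (intro power_mono) auto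
    also have "\<dots> \<le> 2 * ((w k1 - mean (int k1))\<^sup>2 + (w K - mean (int K))\<^sup>2)"
    proof -
      have "(p - q)\<^sup>2 \<le> 2 * (p\<^sup>2 + q\<^sup>2)" for p q :: real
        using zero_le_power2[of "p + q"] by (simp add: power2_eq_square algebra_simps)
      then show ?thesis .
    qed
    also have "(w k1 - mean (int k1))\<^sup>2 + (w K - mean (int K))\<^sup>2 = (\<Sum>k\<in>{k1, K}. (w k - mean (int k))\<^sup>2)"
    proof -
      have "k1 \<noteq> K" using g by (auto simp: g_def x_def)
      then show ?thesis by simp
    qed
    also have "\<dots> \<le> point_energy w"
      unfolding point_energy_def using K(1) k1(1) KZ k1Z by (intro sum_mono2) auto
    finally have g2: "g\<^sup>2 \<le> 2 * point_energy w" by simp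
    have "(H * \<bar>x - Z\<bar>)\<^sup>2 \<le> (2 * \<rho> * g)\<^sup>2" using gH H by (intro power_mono) auto
    also have "\<dots> = 4 * \<rho>\<^sup>2 * g\<^sup>2" by (simp add: power_mult_distrib)
    also have "\<dots> \<le> 4 * \<rho>\<^sup>2 * (2 * point_energy w)" using g2 by (intro mult_left_mono) auto
    finally have 1: "H\<^sup>2 * \<bar>x - Z\<bar>\<^sup>2 \<le> 8 * \<rho>\<^sup>2 * point_energy w" by (simp add: power_mult_distrib)
    \<comment> \<open>Cancelling one factor \<open>\<bar>x - Z\<bar> > 2 * \<rho>\<close> leaves a
      bound linear in the error and quadratic in the noise, which second moments can
      integrate.\<close>
    have "H\<^sup>2 * (2 * \<rho> * \<bar>x - Z\<bar>) \<le> H\<^sup>2 * \<bar>x - Z\<bar>\<^sup>2"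
      using False \<rho> unfolding power2_eq_square[of "\<bar>x - Z\<bar>"] by (intro mult_left_mono mult_right_mono) auto
    with 1 have "(2 * \<rho>) * (H\<^sup>2 * \<bar>x - Z\<bar>) \<le> (2 * \<rho>) * (4 * \<rho> * point_energy w)"
      by (simp add: power2_eq_square algebra_simps)
    then have "H\<^sup>2 * \<bar>x - Z\<bar> \<le> 4 * \<rho> * point_energy w"
      by (rule mult_left_le_imp_le) (use \<rho> in simp)
    then have "\<bar>x - Z\<bar> \<le> 4 * \<rho> * point_energy w / H\<^sup>2" using H by (simp add: field_simps)
    then have "real n * \<bar>x - Z\<bar> \<le> real n * (4 * \<rho> * point_energy w / H\<^sup>2)" by (intro mult_left_mono) auto
    moreover have "0 \<le> 2 * real n * \<rho>" using \<rho> by simp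
    ultimately show ?thesis unfolding Zx by (simp add: mult_ac)
  qed
qed

text \<open>This quantity is at least \<open>1\<close> as soon as the procedure errs at level \<open>j\<close>.\<close>

definition failure_bound :: "(nat \<Rightarrow> real) \<Rightarrow> (nat \<Rightarrow> real) \<Rightarrow> nat \<Rightarrow> real" where
  "failure_bound u w j = (8 * (noise_energy u j + noise_energy w j) + 96 * m j * \<sigma>\<^sup>2) / (gap j)\<^sup>2"

lemma failure_bound_nonneg: "0 \<le> failure_bound u w j"
  using noise_energy_nonneg[of u j] noise_energy_nonneg[of w j] by (simp add: failure_bound_def)

lemma failure_bound_ge_1:
  assumes "(gap j)\<^sup>2 \<le> 8 * noise_energy u j + 96 * m j * \<sigma>\<^sup>2
    \<or> (gap j)\<^sup>2 \<le> 8 * noise_energy w j + 96 * m j * \<sigma>\<^sup>2"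
  shows "1 \<le> failure_bound u w j"
proof -
  have "(gap j)\<^sup>2 \<le> 8 * (noise_energy u j + noise_energy w j) + 96 * m j * \<sigma>\<^sup>2"
    using assms noise_energy_nonneg[of u j] noise_energy_nonneg[of w j]
    unfolding distrib_left by linarith
  then show ?thesis using gap_pos[of j] by (simp add: failure_bound_def pos_le_divide_eq)
qed

text \<open>Induction up to the first failure. Losing the minimizer at \<open>Suc j\<close> is
  charged to the last good level, at cost \<open>6 * m j = 12 * m (Suc j)\<close>; stopping at
  \<open>Suc j\<close> costs \<open>6 * m (Suc j)\<close>.\<close>

lemma error_until_level:
  fixes y z1 z2
  defines "l \<equiv> sample_l n \<sigma> y z1 z2" and "s \<equiv> sample_s n \<sigma> y z1 z2"
    and "u \<equiv> \<lambda>i. y i + sqrt 2 / 2 * \<sigma> * z1 i + sqrt 6 / 2 * \<sigma> * z2 i"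
    and "w \<equiv> \<lambda>i. y i + sqrt 2 / 2 * \<sigma> * z1 i - sqrt 6 / 2 * \<sigma> * z2 i"
  assumes "j \<le> max_level n" "real n * \<rho> < m j"
  shows "real n * \<bar>Z_hat n \<sigma> y z1 z2 - Z\<bar> \<le> (\<Sum>i\<le>j. 12 * m i * failure_bound u w i)
    \<or> located l j \<and> (\<forall>i\<le>j. \<not> stops n \<sigma> l s i)"
  using assms(5,6)
proof (induction j)
  have l: "l = extend_sample n u" and s: "s = extend_sample n w"
    by (simp_all add: l_def s_def u_def w_def sample_l_def sample_s_def)
  have term_le: "c * m i \<le> 12 * m i * failure_bound u w i"
    if "c \<le> 12" "1 \<le> failure_bound u w i" for i c
  proof -
    have "c * m i \<le> 12 * m i" using that by (intro mult_right_mono) auto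
    also have "\<dots> \<le> 12 * m i * failure_bound u w i" using mult_left_mono[OF that(2), of "12 * m i"] by simp
    finally show ?thesis .
  qed
  {
    case 0
    show ?case
    proof (cases "stops n \<sigma> l s 0")
      case True
      then have "1 \<le> failure_bound u w 0"
        using located_stops[OF 0(2) located_0, of l w] by (intro failure_bound_ge_1 disjI2) (simp add: s)
      then have "6 * m 0 \<le> 12 * m 0 * failure_bound u w 0"
        by (intro term_le) auto
      moreover have "real n * \<bar>Z_hat n \<sigma> y z1 z2 - Z\<bar> \<le> 6 * m 0"
        by (intro error_located located_0) simp
      ultimately have "real n * \<bar>Z_hat n \<sigma> y z1 z2 - Z\<bar> \<le> 12 * m 0 * failure_bound u w 0"
        by (rule order_trans[rotated])
      then show ?thesis by simp
    qed (use located_0 in auto)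
  next
    case (Suc j)
    have J: "Suc j \<le> max_level n" by fact
    have mj: "m j = 2 * m (Suc j)" using J by (rule power_max_level_Suc)
    have large: "real n * \<rho> < m j"
    proof -
      have "0 < m (Suc j)" by simp
      then show ?thesis using Suc.prems(2) unfolding mj by linarith
    qed
    have sum_nonneg: "0 \<le> (\<Sum>i\<le>j. 12 * m i * failure_bound u w i)"
      using failure_bound_nonneg by (intro sum_nonneg) simp
    from Suc.IH[OF Suc_leD[OF J] large] show ?case
    proof
      assume *: "real n * \<bar>Z_hat n \<sigma> y z1 z2 - Z\<bar> \<le> (\<Sum>i\<le>j. 12 * m i * failure_bound u w i)"
      have "0 \<le> 12 * m (Suc j) * failure_bound u w (Suc j)" using failure_bound_nonneg by simp
      then show ?case using * by simp
    next
      assume *: "located l j \<and> (\<forall>i\<le>j. \<not> stops n \<sigma> l s i)"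
      have hat: "j \<le> hat_level n \<sigma> l s" "Suc j \<le> hat_level n \<sigma> l s"
        using * J by (auto intro!: le_hat_level)
      show ?case
      proof (cases "located l (Suc j)")
        case False
        then have "1 \<le> failure_bound u w (Suc j)"
          using * not_located_Suc[OF J Suc.prems(2), of u] unfolding l by (intro failure_bound_ge_1 disjI1) simp
        then have "12 * m (Suc j) \<le> 12 * m (Suc j) * failure_bound u w (Suc j)"
          by (intro term_le) auto
        then have "6 * m j \<le> 12 * m (Suc j) * failure_bound u w (Suc j)"
          unfolding mj by linarith
        moreover have "real n * \<bar>Z_hat n \<sigma> y z1 z2 - Z\<bar> \<le> 6 * m j"
          using * hat(1) unfolding l_def s_def by (intro error_located) auto
        ultimately show ?thesis using sum_nonneg unfolding sum.atMost_Suc by linarith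
      next
        case located: True
        show ?thesis
        proof (cases "stops n \<sigma> l s (Suc j)")
          case True
          then have "1 \<le> failure_bound u w (Suc j)"
            using located_stops[OF Suc.prems(2) located, of w] by (intro failure_bound_ge_1 disjI2) (simp add: s)
          then have "6 * m (Suc j) \<le> 12 * m (Suc j) * failure_bound u w (Suc j)"
            by (intro term_le) auto
          moreover have "real n * \<bar>Z_hat n \<sigma> y z1 z2 - Z\<bar> \<le> 6 * m (Suc j)"
            using located hat(2) unfolding l_def s_def by (intro error_located) auto
          ultimately show ?thesis using sum_nonneg unfolding sum.atMost_Suc by linarith
        next
          case False
          then show ?thesis using * located by (auto simp: le_Suc_eq)
        qed
      qed
    qed
  }
qed

text \<open>The levels on which the separation of block means is available. Block lengths decrease,
  so this is an initial segment of the levels.\<close>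

definition coarse_levels :: "nat set" where
  "coarse_levels = {j. j \<le> max_level n \<and> real n * \<rho> < m j}"

text \<open>Without a failure on the coarse levels there are two cases. If the finest level is
  coarse, nothing has stopped and \<open>error_final\<close> applies; otherwise the next block
  length is at most \<open>real n * \<rho>\<close>, and \<open>error_located\<close> gives the term
  with 12.\<close>

lemma error_bound:
  fixes y z1 z2
  defines "u \<equiv> \<lambda>i. y i + sqrt 2 / 2 * \<sigma> * z1 i + sqrt 6 / 2 * \<sigma> * z2 i"
    and "w \<equiv> \<lambda>i. y i + sqrt 2 / 2 * \<sigma> * z1 i - sqrt 6 / 2 * \<sigma> * z2 i"
    and "e \<equiv> \<lambda>i. y i - sqrt 2 * \<sigma> * z1 i"
  shows "real n * \<bar>Z_hat n \<sigma> y z1 z2 - Z\<bar> \<le> 12 * (real n * \<rho>)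
    + (\<Sum>j\<in>coarse_levels. 12 * m j * failure_bound u w j)
    + (if real n * \<rho> < 1 then 4 * (real n * \<rho>) * point_energy e / H\<^sup>2 else 0)"
    (is "?err \<le> 12 * ?r + ?S + ?P")
proof -
  define l s where "l = sample_l n \<sigma> y z1 z2" and "s = sample_s n \<sigma> y z1 z2"
  have r: "0 < ?r" using n \<rho> by simp
  have S: "0 \<le> ?S" using failure_bound_nonneg by (intro sum_nonneg) simp
  have P: "0 \<le> ?P" using r point_energy_nonneg by simp
  show ?thesis
  proof (cases "coarse_levels = {}")
    case True
    then have "m 0 \<le> ?r" by (auto simp: coarse_levels_def not_less)
    moreover have "?err \<le> 6 * m 0" by (intro error_located located_0) simp
    ultimately show ?thesis using r S P by linarith
  next
    case False
    define j where "j = Max coarse_levels"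
    have fin: "finite coarse_levels" by (rule finite_subset[of _ "{..max_level n}"]) (auto simp: coarse_levels_def)
    have j: "j \<le> max_level n" "?r < m j"
      using Max_in[OF fin False] by (auto simp: j_def coarse_levels_def)
    have sub: "{..j} \<subseteq> coarse_levels"
    proof
      fix i assume i: "i \<in> {..j}"
      have "m j \<le> m i" using i by (intro power_increasing) auto
      with j(2) have "?r < m i" by (rule less_le_trans)
      then show "i \<in> coarse_levels" using i j by (simp add: coarse_levels_def)
    qed
    from error_until_level[OF j, of y z1 z2, folded u_def w_def l_def s_def]
    show ?thesis
    proof
      assume "?err \<le> (\<Sum>i\<le>j. 12 * m i * failure_bound u w i)"
      also have "\<dots> \<le> ?S" using failure_bound_nonneg by (intro sum_mono2 fin sub) simp
      finally show ?thesis using r P by linarith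
    next
      assume *: "located l j \<and> (\<forall>i\<le>j. \<not> stops n \<sigma> l s i)"
      show ?thesis
      proof (cases "j = max_level n")
        case True
        then have small: "?r < 1" using j by simp
        have "\<not> check_level n \<sigma> l s < \<infinity>" using * True by (intro check_level_eq_infinity) auto
        then have "?err \<le> 2 * real n * \<rho> + 4 * real n * \<rho> * point_energy e / H\<^sup>2"
          using * small unfolding True l_def s_def e_def by (intro error_final) auto
        then have "?err \<le> 2 * ?r + ?P" using small by (simp add: mult.assoc)
        then show ?thesis using r S by linarith
      next
        case False
        then have J: "Suc j \<le> max_level n" using j by simp
        have "Suc j \<notin> coarse_levels" using Max_ge[OF fin, of "Suc j"] by (auto simp: j_def)
        then have "m (Suc j) \<le> ?r" using J by (simp add: coarse_levels_def)
        moreover have "m j = 2 * m (Suc j)" using J by (rule power_max_level_Suc)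
        moreover have "?err \<le> 6 * m j"
          using * j unfolding l_def s_def by (intro error_located le_hat_level) auto
        ultimately show ?thesis using S P by linarith
      qed
    qed
  qed
qed

end

subsection \<open>Integration of the error bound\<close>


lemma square_add3_le: "(a + b + c)\<^sup>2 \<le> 3 * (a\<^sup>2 + b\<^sup>2 + c\<^sup>2)" for a b c :: real
  using zero_le_power2[of "a - b"] zero_le_power2[of "b - c"] zero_le_power2[of "a - c"]
  by (simp add: power2_eq_square algebra_simps)

section \<open>The joint law of data and auxiliary noise\<close>

lemma sets_data_law [measurable_cong]: "sets (data_law n \<sigma> f) = sets (\<Pi>\<^sub>M i\<in>{0..n}. borel)"
  by (simp add: data_law_def)

lemma prob_space_data_law: "prob_space (data_law n \<sigma> f)"
  unfolding data_law_def
  by (intro prob_space.prob_space_distr prob_space_noise measurable_affine_noise)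

lemma nn_integral_noise_sum_square:
  assumes A: "A \<subseteq> {0..n}"
  shows "(\<integral>\<^sup>+z. ennreal ((\<Sum>k\<in>A. c * z k)\<^sup>2) \<partial>noise n) = ennreal (c\<^sup>2 * real (card A))"
proof -
  let ?t = "\<lambda>i. if i \<in> A then c else 0"
  have 1: "(\<Sum>k\<in>A. c * z k) = (\<Sum>i\<in>{0..n}. ?t i * z i)" for z
    using A by (intro sum.mono_neutral_cong_left) auto
  have 2: "(\<Sum>i\<in>{0..n}. (?t i)\<^sup>2) = (\<Sum>i\<in>A. c\<^sup>2)"
    using A by (intro sum.mono_neutral_cong_right) auto
  show ?thesis unfolding 1 nn_integral_noise_square 2 by (simp add: mult.commute)
qed

lemma nn_integral_data_law_sum_square:
  assumes A: "A \<subseteq> {0..n}"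
  shows "(\<integral>\<^sup>+y. ennreal ((\<Sum>k\<in>A. y k - f (real k / real n))\<^sup>2) \<partial>data_law n \<sigma> f)
    = ennreal (\<sigma>\<^sup>2 * real (card A))"
proof -
  have "(\<lambda>y. \<Sum>k\<in>A. y k - f (real k / real n)) \<in> borel_measurable (\<Pi>\<^sub>M i\<in>{0..n}. borel)"
    using A by (intro borel_measurable_sum borel_measurable_diff measurable_component_singleton) auto
  then have 1: "(\<integral>\<^sup>+y. ennreal ((\<Sum>k\<in>A. y k - f (real k / real n))\<^sup>2) \<partial>data_law n \<sigma> f)
    = (\<integral>\<^sup>+z. ennreal ((\<Sum>k\<in>A. (\<lambda>i\<in>{0..n}. f (real i / real n) + \<sigma> * z i) k - f (real k / real n))\<^sup>2) \<partial>noise n)"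
    unfolding data_law_def by (subst nn_integral_distr) auto
  have 2: "(\<Sum>k\<in>A. (\<lambda>i\<in>{0..n}. f (real i / real n) + \<sigma> * z i) k - f (real k / real n))
    = (\<Sum>k\<in>A. \<sigma> * z k)" for z
    using A by (intro sum.cong) auto
  show ?thesis unfolding 1 2 using A by (rule nn_integral_noise_sum_square)
qed

definition joint_law :: "nat \<Rightarrow> real \<Rightarrow> (real \<Rightarrow> real) \<Rightarrow> ((nat \<Rightarrow> real) \<times> (nat \<Rightarrow> real) \<times> (nat \<Rightarrow> real)) measure" where
  "joint_law n \<sigma> f = data_law n \<sigma> f \<Otimes>\<^sub>M (noise n \<Otimes>\<^sub>M noise n)"

lemma distr_pair_snd:
  assumes "prob_space M" "sigma_finite_measure N"
  shows "distr (M \<Otimes>\<^sub>M N) N snd = N"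
proof (rule measure_eqI)
  fix X assume "X \<in> sets (distr (M \<Otimes>\<^sub>M N) N snd)"
  then have X: "X \<in> sets N" by simp
  have "snd -` X \<inter> space (M \<Otimes>\<^sub>M N) = space M \<times> X"
    using sets.sets_into_space[OF X] by (auto simp: space_pair_measure)
  then show "emeasure (distr (M \<Otimes>\<^sub>M N) N snd) X = emeasure N X"
    using X assms
    by (simp add: emeasure_distr sigma_finite_measure.emeasure_pair_measure_Times prob_space.emeasure_space_1)
qed simp

lemma distr_joint_law:
  "distr (joint_law n \<sigma> f) (data_law n \<sigma> f) fst = data_law n \<sigma> f"
  "distr (joint_law n \<sigma> f) (noise n) (\<lambda>\<omega>. fst (snd \<omega>)) = noise n"
  "distr (joint_law n \<sigma> f) (noise n) (\<lambda>\<omega>. snd (snd \<omega>)) = noise n"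
proof -
  interpret D: prob_space "data_law n \<sigma> f" by (rule prob_space_data_law)
  interpret N: prob_space "noise n" by (rule prob_space_noise)
  interpret NN: pair_prob_space "noise n" "noise n" ..
  interpret DN: pair_prob_space "data_law n \<sigma> f" "noise n \<Otimes>\<^sub>M noise n" ..
  show "distr (joint_law n \<sigma> f) (data_law n \<sigma> f) fst = data_law n \<sigma> f"
    unfolding joint_law_def by (rule NN.distr_pair_fst)
  have snd: "distr (joint_law n \<sigma> f) (noise n \<Otimes>\<^sub>M noise n) snd = noise n \<Otimes>\<^sub>M noise n"
    unfolding joint_law_def by (intro distr_pair_snd D.prob_space_axioms NN.sigma_finite_measure_axioms)
  have "distr (joint_law n \<sigma> f) (noise n) (\<lambda>\<omega>. fst (snd \<omega>)) = distr (distr (joint_law n \<sigma> f) (noise n \<Otimes>\<^sub>M noise n) snd) (noise n) fst"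
    unfolding joint_law_def by (subst distr_distr) (auto simp: comp_def)
  also have "\<dots> = noise n" unfolding snd by (rule N.distr_pair_fst)
  finally show "distr (joint_law n \<sigma> f) (noise n) (\<lambda>\<omega>. fst (snd \<omega>)) = noise n" .
  have "distr (joint_law n \<sigma> f) (noise n) (\<lambda>\<omega>. snd (snd \<omega>)) = distr (distr (joint_law n \<sigma> f) (noise n \<Otimes>\<^sub>M noise n) snd) (noise n) snd"
    unfolding joint_law_def by (subst distr_distr) (auto simp: comp_def)
  also have "\<dots> = noise n" unfolding snd by (intro distr_pair_snd N.prob_space_axioms N.sigma_finite_measure_axioms)
  finally show "distr (joint_law n \<sigma> f) (noise n) (\<lambda>\<omega>. snd (snd \<omega>)) = noise n" .
qed

lemma prob_space_joint_law: "prob_space (joint_law n \<sigma> f)"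
proof -
  interpret D: prob_space "data_law n \<sigma> f" by (rule prob_space_data_law)
  interpret N: prob_space "noise n" by (rule prob_space_noise)
  interpret NN: pair_prob_space "noise n" "noise n" ..
  interpret DN: pair_prob_space "data_law n \<sigma> f" "noise n \<Otimes>\<^sub>M noise n" ..
  show ?thesis unfolding joint_law_def by (rule DN.prob_space_axioms)
qed

lemma measurable_joint_law [measurable]:
  "fst \<in> joint_law n \<sigma> f \<rightarrow>\<^sub>M data_law n \<sigma> f"
  "(\<lambda>\<omega>. fst (snd \<omega>)) \<in> joint_law n \<sigma> f \<rightarrow>\<^sub>M noise n"
  "(\<lambda>\<omega>. snd (snd \<omega>)) \<in> joint_law n \<sigma> f \<rightarrow>\<^sub>M noise n"
  by (auto simp: joint_law_def)

lemma measurable_data_law_component [measurable]: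
  "i \<le> n \<Longrightarrow> (\<lambda>y. y i) \<in> borel_measurable (data_law n \<sigma> f)"
  by (subst measurable_cong_sets[OF sets_data_law refl]) (rule measurable_component_singleton, simp)

text \<open>The three derived samples of the procedure are instances with \<open>a\<^sup>2 + b\<^sup>2 = 2 \<sigma>\<^sup>2\<close>.\<close>

definition mixed_sample :: "real \<Rightarrow> real \<Rightarrow> (nat \<Rightarrow> real) \<times> (nat \<Rightarrow> real) \<times> (nat \<Rightarrow> real) \<Rightarrow> nat \<Rightarrow> real" where
  "mixed_sample a b \<omega> i = fst \<omega> i + a * fst (snd \<omega>) i + b * snd (snd \<omega>) i"

lemma measurable_mixed_sample [measurable]:
  assumes "i \<le> n"
  shows "(\<lambda>\<omega>. mixed_sample a b \<omega> i) \<in> borel_measurable (joint_law n \<sigma> f)"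
  unfolding mixed_sample_def
  by (intro borel_measurable_add borel_measurable_times borel_measurable_const
      measurable_compose[OF measurable_joint_law(1) measurable_data_law_component[OF assms]]
      measurable_compose[OF measurable_joint_law(2) measurable_noise_component[OF assms]]
      measurable_compose[OF measurable_joint_law(3) measurable_noise_component[OF assms]])

text \<open>The factor \<open>3\<close> is not sharp: it avoids computing the cross terms.\<close>

lemma nn_integral_mixed_sample_sum_square:
  assumes A: "A \<subseteq> {0..n}"
  shows "(\<integral>\<^sup>+\<omega>. ennreal ((\<Sum>k\<in>A. mixed_sample a b \<omega> k - f (real k / real n))\<^sup>2) \<partial>joint_law n \<sigma> f)
    \<le> ennreal (3 * (\<sigma>\<^sup>2 + a\<^sup>2 + b\<^sup>2) * real (card A))"
proof -
  let ?P = "joint_law n \<sigma> f"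
  let ?X = "\<lambda>y. \<Sum>k\<in>A. y k - f (real k / real n)"
  let ?Y = "\<lambda>c z. \<Sum>k\<in>A. c * z k"
  have X: "?X \<in> borel_measurable (data_law n \<sigma> f)"
    using A by (intro borel_measurable_sum borel_measurable_diff measurable_data_law_component) auto
  have Y: "?Y c \<in> borel_measurable (noise n)" for c
    using A by (intro borel_measurable_sum borel_measurable_times measurable_noise_component) auto
  have [measurable]: "(\<lambda>\<omega>. ?X (fst \<omega>)) \<in> borel_measurable ?P"
    by (rule measurable_compose[OF measurable_joint_law(1) X])
  have [measurable]: "(\<lambda>\<omega>. ?Y c (fst (snd \<omega>))) \<in> borel_measurable ?P" for c
    by (rule measurable_compose[OF measurable_joint_law(2) Y])
  have [measurable]: "(\<lambda>\<omega>. ?Y c (snd (snd \<omega>))) \<in> borel_measurable ?P" for c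
    by (rule measurable_compose[OF measurable_joint_law(3) Y])
  have iX: "(\<integral>\<^sup>+\<omega>. ennreal ((?X (fst \<omega>))\<^sup>2) \<partial>?P) = ennreal (\<sigma>\<^sup>2 * real (card A))"
  proof -
    have "integral\<^sup>N (distr ?P (data_law n \<sigma> f) fst) (\<lambda>y. ennreal ((?X y)\<^sup>2)) = (\<integral>\<^sup>+\<omega>. ennreal ((?X (fst \<omega>))\<^sup>2) \<partial>?P)"
      by (rule nn_integral_distr[OF measurable_joint_law(1)]) (use X in simp)
    then show ?thesis by (simp only: distr_joint_law nn_integral_data_law_sum_square[OF A])
  qed
  have iY: "(\<integral>\<^sup>+\<omega>. ennreal ((?Y c (fst (snd \<omega>)))\<^sup>2) \<partial>?P) = ennreal (c\<^sup>2 * real (card A))" for c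
  proof -
    have "integral\<^sup>N (distr ?P (noise n) (\<lambda>\<omega>. fst (snd \<omega>))) (\<lambda>z. ennreal ((?Y c z)\<^sup>2)) = (\<integral>\<^sup>+\<omega>. ennreal ((?Y c (fst (snd \<omega>)))\<^sup>2) \<partial>?P)"
      by (rule nn_integral_distr[OF measurable_joint_law(2)]) (use Y in simp)
    then show ?thesis by (simp only: distr_joint_law nn_integral_noise_sum_square[OF A])
  qed
  have iZ: "(\<integral>\<^sup>+\<omega>. ennreal ((?Y c (snd (snd \<omega>)))\<^sup>2) \<partial>?P) = ennreal (c\<^sup>2 * real (card A))" for c
  proof -
    have "integral\<^sup>N (distr ?P (noise n) (\<lambda>\<omega>. snd (snd \<omega>))) (\<lambda>z. ennreal ((?Y c z)\<^sup>2)) = (\<integral>\<^sup>+\<omega>. ennreal ((?Y c (snd (snd \<omega>)))\<^sup>2) \<partial>?P)"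
      by (rule nn_integral_distr[OF measurable_joint_law(3)]) (use Y in simp)
    then show ?thesis by (simp only: distr_joint_law nn_integral_noise_sum_square[OF A])
  qed
  have "(\<integral>\<^sup>+\<omega>. ennreal ((\<Sum>k\<in>A. mixed_sample a b \<omega> k - f (real k / real n))\<^sup>2) \<partial>?P)
    \<le> (\<integral>\<^sup>+\<omega>. 3 * (ennreal ((?X (fst \<omega>))\<^sup>2) + ennreal ((?Y a (fst (snd \<omega>)))\<^sup>2) + ennreal ((?Y b (snd (snd \<omega>)))\<^sup>2)) \<partial>?P)"
  proof (rule nn_integral_mono)
    fix \<omega>
    have "(\<Sum>k\<in>A. mixed_sample a b \<omega> k - f (real k / real n))
      = ?X (fst \<omega>) + ?Y a (fst (snd \<omega>)) + ?Y b (snd (snd \<omega>))"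
      by (simp add: mixed_sample_def sum_subtractf sum.distrib)
    then have "(\<Sum>k\<in>A. mixed_sample a b \<omega> k - f (real k / real n))\<^sup>2
      \<le> 3 * ((?X (fst \<omega>))\<^sup>2 + (?Y a (fst (snd \<omega>)))\<^sup>2 + (?Y b (snd (snd \<omega>)))\<^sup>2)"
      by (simp only: square_add3_le)
    then have "ennreal ((\<Sum>k\<in>A. mixed_sample a b \<omega> k - f (real k / real n))\<^sup>2)
      \<le> ennreal (3 * ((?X (fst \<omega>))\<^sup>2 + (?Y a (fst (snd \<omega>)))\<^sup>2 + (?Y b (snd (snd \<omega>)))\<^sup>2))"
      by (rule ennreal_leI)
    then show "ennreal ((\<Sum>k\<in>A. mixed_sample a b \<omega> k - f (real k / real n))\<^sup>2)
      \<le> 3 * (ennreal ((?X (fst \<omega>))\<^sup>2) + ennreal ((?Y a (fst (snd \<omega>)))\<^sup>2) + ennreal ((?Y b (snd (snd \<omega>)))\<^sup>2))"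
      by (simp add: ennreal_mult)
  qed
  also have "\<dots> = 3 * (ennreal (\<sigma>\<^sup>2 * real (card A)) + ennreal (a\<^sup>2 * real (card A)) + ennreal (b\<^sup>2 * real (card A)))"
    by (simp add: nn_integral_cmult nn_integral_add iX iY iZ)
  also have "\<dots> = ennreal (3 * (\<sigma>\<^sup>2 * real (card A) + a\<^sup>2 * real (card A) + b\<^sup>2 * real (card A)))"
    by (simp add: ennreal_mult)
  also have "3 * (\<sigma>\<^sup>2 * real (card A) + a\<^sup>2 * real (card A) + b\<^sup>2 * real (card A))
      = 3 * (\<sigma>\<^sup>2 + a\<^sup>2 + b\<^sup>2) * real (card A)"
    by (simp add: algebra_simps)
  finally show ?thesis .
qed

section \<open>Expected costs of failures\<close>

context level_set_profile
begin

text \<open>Blocks consist of integers while the noise is indexed by naturals; these facts transfer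
  blocks inside the sample.\<close>

lemma nat_block:
  assumes "valid n j i"
  shows "inj_on nat (block n j i)" "nat ` block n j i \<subseteq> {0..n}"
    "card (nat ` block n j i) = 2 ^ (max_level n - j)"
proof -
  have sub: "block n j i \<subseteq> {0..int n}" using assms by (rule valid_block_subset)
  show inj: "inj_on nat (block n j i)"
    by (rule inj_on_subset[of nat "{0..}"]) (use sub in \<open>auto simp: inj_on_def\<close>)
  show "nat ` block n j i \<subseteq> {0..n}" using sub by (force simp: nat_le_iff)
  show "card (nat ` block n j i) = 2 ^ (max_level n - j)" by (simp add: card_image[OF inj])
qed

lemma block_noise_eq:
  assumes "valid n j i"
  shows "block_noise w j i = (\<Sum>k\<in>nat ` block n j i. w k - f (real k / real n))"
  unfolding block_noise_def sum.reindex[OF nat_block(1)[OF assms]] comp_def mean_def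
  using valid_block_subset[OF assms] by (intro sum.cong) auto

lemma measurable_block_noise:
  assumes "valid n j i"
  shows "(\<lambda>\<omega>. block_noise (mixed_sample a b \<omega>) j i) \<in> borel_measurable (joint_law n \<sigma> f)"
  unfolding block_noise_eq[OF assms]
  using nat_block(2)[OF assms] by (intro borel_measurable_sum borel_measurable_diff measurable_mixed_sample) auto

lemma measurable_noise_energy [measurable]:
  "(\<lambda>\<omega>. noise_energy (mixed_sample a b \<omega>) j) \<in> borel_measurable (joint_law n \<sigma> f)"
  unfolding noise_energy_def
  by (intro borel_measurable_sum borel_measurable_power measurable_block_noise) (simp add: near_blocks_def)

text \<open>The constant is 15 blocks times \<open>9 * \<sigma>\<^sup>2\<close> per design point,
  where the 9 comes from \<open>3 * (\<sigma>\<^sup>2 + a\<^sup>2 + b\<^sup>2)\<close>.\<close>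

lemma nn_integral_noise_energy:
  assumes "a\<^sup>2 + b\<^sup>2 = 2 * \<sigma>\<^sup>2"
  shows "(\<integral>\<^sup>+\<omega>. ennreal (noise_energy (mixed_sample a b \<omega>) j) \<partial>joint_law n \<sigma> f) \<le> ennreal (135 * \<sigma>\<^sup>2 * m j)"
proof -
  have valid: "valid n j i" if "i \<in> near_blocks j" for i using that by (simp add: near_blocks_def)
  have var: "3 * (\<sigma>\<^sup>2 + a\<^sup>2 + b\<^sup>2) = 9 * \<sigma>\<^sup>2" using assms by simp
  have "(\<integral>\<^sup>+\<omega>. ennreal (noise_energy (mixed_sample a b \<omega>) j) \<partial>joint_law n \<sigma> f)
    = (\<Sum>i\<in>near_blocks j. \<integral>\<^sup>+\<omega>. ennreal ((block_noise (mixed_sample a b \<omega>) j i)\<^sup>2) \<partial>joint_law n \<sigma> f)"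
    unfolding noise_energy_def
    by (subst sum_ennreal[symmetric], simp, subst nn_integral_sum)
       (auto intro!: measurable_compose[OF measurable_block_noise[OF valid]])
  also have "\<dots> \<le> (\<Sum>i\<in>near_blocks j. ennreal (9 * \<sigma>\<^sup>2 * m j))"
  proof (rule sum_mono)
    fix i assume "i \<in> near_blocks j"
    then have v: "valid n j i" by (rule valid)
    show "(\<integral>\<^sup>+\<omega>. ennreal ((block_noise (mixed_sample a b \<omega>) j i)\<^sup>2) \<partial>joint_law n \<sigma> f) \<le> ennreal (9 * \<sigma>\<^sup>2 * m j)"
      using nn_integral_mixed_sample_sum_square[OF nat_block(2)[OF v], where a = a and b = b and f = f and \<sigma> = \<sigma>]
      unfolding block_noise_eq[OF v] var nat_block(3)[OF v] by simp
  qed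
  also have "\<dots> = ennreal (real (card (near_blocks j)) * (9 * \<sigma>\<^sup>2 * m j))"
    by (simp add: ennreal_mult ennreal_of_nat_eq_real_of_nat)
  also have "\<dots> \<le> ennreal (15 * (9 * \<sigma>\<^sup>2 * m j))"
  proof (intro ennreal_leI mult_right_mono)
    have "card (near_blocks j) \<le> card {iZ j - 7..iZ j + 7}"
      by (intro card_mono) (auto simp: near_blocks_def)
    then show "real (card (near_blocks j)) \<le> 15" by simp
  qed simp
  finally show ?thesis by (simp add: mult.assoc)
qed

lemma measurable_point_energy [measurable]:
  "(\<lambda>\<omega>. point_energy (mixed_sample a b \<omega>)) \<in> borel_measurable (joint_law n \<sigma> f)"
  unfolding point_energy_def
  by (intro borel_measurable_sum borel_measurable_power borel_measurable_diff measurable_mixed_sample) auto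

lemma nn_integral_point_energy:
  assumes "a\<^sup>2 + b\<^sup>2 = 2 * \<sigma>\<^sup>2"
  shows "(\<integral>\<^sup>+\<omega>. ennreal (point_energy (mixed_sample a b \<omega>)) \<partial>joint_law n \<sigma> f) \<le> ennreal (99 * \<sigma>\<^sup>2)"
proof -
  define A where "A = {k\<in>{0..n}. \<bar>real k - real n * Z\<bar> \<le> 5}"
  have var: "3 * (\<sigma>\<^sup>2 + a\<^sup>2 + b\<^sup>2) = 9 * \<sigma>\<^sup>2" using assms by simp
  have "(\<integral>\<^sup>+\<omega>. ennreal (point_energy (mixed_sample a b \<omega>)) \<partial>joint_law n \<sigma> f)
    = (\<Sum>k\<in>A. \<integral>\<^sup>+\<omega>. ennreal ((mixed_sample a b \<omega> k - mean (int k))\<^sup>2) \<partial>joint_law n \<sigma> f)"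
    unfolding point_energy_def A_def[symmetric]
    by (subst sum_ennreal[symmetric], simp, subst nn_integral_sum)
       (auto simp: A_def intro!: measurable_compose[OF borel_measurable_diff[OF measurable_mixed_sample]])
  also have "\<dots> \<le> (\<Sum>k\<in>A. ennreal (9 * \<sigma>\<^sup>2))"
  proof (rule sum_mono)
    fix k assume "k \<in> A"
    then have "{k} \<subseteq> {0..n}" by (simp add: A_def)
    from nn_integral_mixed_sample_sum_square[OF this, where a = a and b = b and f = f and \<sigma> = \<sigma>]
    show "(\<integral>\<^sup>+\<omega>. ennreal ((mixed_sample a b \<omega> k - mean (int k))\<^sup>2) \<partial>joint_law n \<sigma> f) \<le> ennreal (9 * \<sigma>\<^sup>2)"
      unfolding var mean_def by simp
  qed
  also have "\<dots> = ennreal (real (card A) * (9 * \<sigma>\<^sup>2))"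
    by (simp add: ennreal_mult ennreal_of_nat_eq_real_of_nat)
  \<comment> \<open>Within \<open>5 / real n\<close> of \<open>Z\<close> there are at most
    \<open>2 * 5 + 1 = 11\<close> design points.\<close>
  also have "\<dots> \<le> ennreal (11 * (9 * \<sigma>\<^sup>2))"
  proof (intro ennreal_leI mult_right_mono)
    have "A = {k\<in>{0..n}. \<bar>real k / real n - Z\<bar> \<le> 5 / real n}"
    proof -
      have "\<bar>real k / real n - Z\<bar> \<le> 5 / real n \<longleftrightarrow> \<bar>real k - real n * Z\<bar> \<le> 5" for k
      proof -
        have "\<bar>real k - real n * Z\<bar> = real n * \<bar>real k / real n - Z\<bar>"
          using n by (simp add: abs_mult_pos' right_diff_distrib)
        then show ?thesis using n by (simp add: field_simps)
      qed
      then show ?thesis unfolding A_def by simp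
    qed
    then show "real (card A) \<le> 11" using card_design_points_le[OF n, of "5 / real n" Z] n by simp
  qed simp
  finally show ?thesis by simp
qed

text \<open>A geometric series of ratio 4, dominated by its finest term. The constant 2 closes the
  induction because \<open>2 / 4 + 1 \<le> 2\<close>.\<close>

lemma sum_inverse_square_levels:
  "j \<le> max_level n \<Longrightarrow> (\<Sum>i\<le>j. 1 / (m i)\<^sup>2) \<le> 2 / (m j)\<^sup>2"
proof (induction j)
  case 0
  then show ?case by (simp add: divide_right_mono)
next
  case (Suc j)
  have "m j = 2 * m (Suc j)" using Suc.prems by (rule power_max_level_Suc)
  then have "2 / (m j)\<^sup>2 = (1 / 2) / (m (Suc j))\<^sup>2" by (simp add: power_mult_distrib)
  moreover have "(\<Sum>i\<le>j. 1 / (m i)\<^sup>2) \<le> 2 / (m j)\<^sup>2" using Suc by simp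
  ultimately have "(\<Sum>i\<le>Suc j. 1 / (m i)\<^sup>2) \<le> (1 / 2) / (m (Suc j))\<^sup>2 + 1 / (m (Suc j))\<^sup>2"
    unfolding sum.atMost_Suc by linarith
  also have "\<dots> = (3 / 2) / (m (Suc j))\<^sup>2" by (simp add: field_simps)
  also have "\<dots> \<le> 2 / (m (Suc j))\<^sup>2" by (intro divide_right_mono) auto
  finally show ?case .
qed

lemma finite_coarse_levels [simp]: "finite coarse_levels"
  by (rule finite_subset[of _ "{..max_level n}"]) (auto simp: coarse_levels_def)

text \<open>Here the costs of all levels collapse to order \<open>r = real n * \<rho>\<close>: at
  the finest coarse level, \<open>2 * r + 1 \<le> 3 * m j\<close> and
  \<open>r\<^sup>2 \<le> r * m j\<close> cancel the denominator.\<close>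

lemma sum_coarse_levels:
  "(\<Sum>j\<in>coarse_levels. (2 * (real n * \<rho>) + 1) * (real n * \<rho>)\<^sup>2 / (m j)\<^sup>2) \<le> 6 * (real n * \<rho>)"
    (is "(\<Sum>j\<in>_. (2 * ?r + 1) * ?r\<^sup>2 / _) \<le> _")
proof (cases "coarse_levels = {}")
  case True
  then show ?thesis using \<rho> by simp
next
  case False
  have r: "0 < ?r" using n \<rho> by simp
  define j where "j = Max coarse_levels"
  have j: "j \<le> max_level n" "?r < m j"
    using Max_in[OF finite_coarse_levels False] by (auto simp: j_def coarse_levels_def)
  have "(\<Sum>i\<in>coarse_levels. 1 / (m i)\<^sup>2) \<le> (\<Sum>i\<le>j. 1 / (m i)\<^sup>2)"
    by (intro sum_mono2) (auto simp: j_def)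
  also have "\<dots> \<le> 2 / (m j)\<^sup>2" using j(1) by (rule sum_inverse_square_levels)
  finally have "(2 * ?r + 1) * ?r\<^sup>2 * (\<Sum>i\<in>coarse_levels. 1 / (m i)\<^sup>2) \<le> (2 * ?r + 1) * ?r\<^sup>2 * (2 / (m j)\<^sup>2)"
    using r by (intro mult_left_mono) auto
  also have "(2 * ?r + 1) * ?r\<^sup>2 * (2 / (m j)\<^sup>2) \<le> (3 * m j) * (?r * m j) * (2 / (m j)\<^sup>2)"
  proof (intro mult_right_mono mult_mono)
    have "1 \<le> m j" by simp
    then show "2 * ?r + 1 \<le> 3 * m j" using j(2) by linarith
    show "?r\<^sup>2 \<le> ?r * m j" unfolding power2_eq_square using j(2) r by (intro mult_left_mono) auto
  qed (use r in auto)
  also have "\<dots> = 6 * ?r"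
  proof -
    have "(3 * c) * (x * c) * (2 / c\<^sup>2) = 6 * x" if "c > 0" for c x :: real
      using that by (simp add: field_simps power2_eq_square)
    from this[of "m j" ?r] show ?thesis by (metis zero_less_power zero_less_numeral)
  qed
  finally show ?thesis by (simp add: sum_distrib_left)
qed

text \<open>The relation \<open>noise_le\<close> eliminates \<open>H\<close> and
  \<open>\<sigma>\<close>. The constant is \<open>12 * (2 * 8 * 135 + 96)\<close>.\<close>

lemma expected_failure_bound:
  assumes "a\<^sup>2 + b\<^sup>2 = 2 * \<sigma>\<^sup>2" "c\<^sup>2 + d\<^sup>2 = 2 * \<sigma>\<^sup>2"
  shows "(\<integral>\<^sup>+\<omega>. ennreal (12 * m j * failure_bound (mixed_sample a b \<omega>) (mixed_sample c d \<omega>) j) \<partial>joint_law n \<sigma> f)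
    \<le> ennreal (27072 * ((2 * (real n * \<rho>) + 1) * (real n * \<rho>)\<^sup>2 / (m j)\<^sup>2))"
proof -
  interpret P: prob_space "joint_law n \<sigma> f" by (rule prob_space_joint_law)
  define q where "q = 12 * m j / (gap j)\<^sup>2"
  have q: "0 \<le> q" by (simp add: q_def)
  have "(\<integral>\<^sup>+\<omega>. ennreal (12 * m j * failure_bound (mixed_sample a b \<omega>) (mixed_sample c d \<omega>) j) \<partial>joint_law n \<sigma> f)
    = (\<integral>\<^sup>+\<omega>. ennreal (8 * q) * ennreal (noise_energy (mixed_sample a b \<omega>) j)
        + ennreal (8 * q) * ennreal (noise_energy (mixed_sample c d \<omega>) j) + ennreal (q * (96 * m j * \<sigma>\<^sup>2)) \<partial>joint_law n \<sigma> f)"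
  proof (rule nn_integral_cong)
    fix \<omega>
    have "12 * m j * failure_bound (mixed_sample a b \<omega>) (mixed_sample c d \<omega>) j
      = 8 * q * noise_energy (mixed_sample a b \<omega>) j + 8 * q * noise_energy (mixed_sample c d \<omega>) j + q * (96 * m j * \<sigma>\<^sup>2)"
      by (simp add: failure_bound_def q_def add_divide_distrib algebra_simps)
    then show "ennreal (12 * m j * failure_bound (mixed_sample a b \<omega>) (mixed_sample c d \<omega>) j)
      = ennreal (8 * q) * ennreal (noise_energy (mixed_sample a b \<omega>) j)
        + ennreal (8 * q) * ennreal (noise_energy (mixed_sample c d \<omega>) j) + ennreal (q * (96 * m j * \<sigma>\<^sup>2))"
      using q noise_energy_nonneg by (simp add: ennreal_mult')
  qed
  also have "\<dots> = ennreal (8 * q) * (\<integral>\<^sup>+\<omega>. ennreal (noise_energy (mixed_sample a b \<omega>) j) \<partial>joint_law n \<sigma> f)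
    + ennreal (8 * q) * (\<integral>\<^sup>+\<omega>. ennreal (noise_energy (mixed_sample c d \<omega>) j) \<partial>joint_law n \<sigma> f)
    + ennreal (q * (96 * m j * \<sigma>\<^sup>2))"
    by (simp add: nn_integral_add nn_integral_cmult P.emeasure_space_1)
  also have "\<dots> \<le> ennreal (8 * q) * ennreal (135 * \<sigma>\<^sup>2 * m j) + ennreal (8 * q) * ennreal (135 * \<sigma>\<^sup>2 * m j)
    + ennreal (q * (96 * m j * \<sigma>\<^sup>2))"
    by (intro add_mono mult_left_mono nn_integral_noise_energy assms) auto
  also have "\<dots> = ennreal (8 * q * (135 * \<sigma>\<^sup>2 * m j) + 8 * q * (135 * \<sigma>\<^sup>2 * m j) + q * (96 * m j * \<sigma>\<^sup>2))"
  proof -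
    have 1: "ennreal (8 * q) * ennreal x = ennreal (8 * q * x)" for x
      using q by (intro ennreal_mult'[symmetric]) simp
    have "0 \<le> 8 * q * (135 * \<sigma>\<^sup>2 * m j)" "0 \<le> q * (96 * m j * \<sigma>\<^sup>2)" using q by simp_all
    then show ?thesis unfolding 1 by (simp only: ennreal_plus add_nonneg_nonneg)
  qed
  also have "\<dots> \<le> ennreal (27072 * ((2 * (real n * \<rho>) + 1) * (real n * \<rho>)\<^sup>2 / (m j)\<^sup>2))"
  proof (rule ennreal_leI)
    have "8 * q * (135 * \<sigma>\<^sup>2 * m j) + 8 * q * (135 * \<sigma>\<^sup>2 * m j) + q * (96 * m j * \<sigma>\<^sup>2) = 2256 * q * m j * \<sigma>\<^sup>2"
      by (simp add: algebra_simps)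
    also have "\<dots> = 27072 * ((m j)\<^sup>2 / (gap j)\<^sup>2) * \<sigma>\<^sup>2"
      by (simp add: q_def power2_eq_square)
    also have "(m j)\<^sup>2 / (gap j)\<^sup>2 = (real n * \<rho>)\<^sup>2 / ((m j)\<^sup>2 * H\<^sup>2)"
      using H n \<rho> by (simp add: gap_def power_divide power_mult_distrib power2_eq_square mult_ac)
    also have "27072 * ((real n * \<rho>)\<^sup>2 / ((m j)\<^sup>2 * H\<^sup>2)) * \<sigma>\<^sup>2
      \<le> 27072 * ((real n * \<rho>)\<^sup>2 / ((m j)\<^sup>2 * H\<^sup>2)) * ((2 * real n * \<rho> + 1) * H\<^sup>2)"
      by (intro mult_left_mono noise_le) simp
    also have "\<dots> = 27072 * ((2 * (real n * \<rho>) + 1) * (real n * \<rho>)\<^sup>2 / (m j)\<^sup>2)"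
      using H by simp
    finally show "8 * q * (135 * \<sigma>\<^sup>2 * m j) + 8 * q * (135 * \<sigma>\<^sup>2 * m j) + q * (96 * m j * \<sigma>\<^sup>2)
      \<le> 27072 * ((2 * (real n * \<rho>) + 1) * (real n * \<rho>)\<^sup>2 / (m j)\<^sup>2)" .
  qed
  finally show ?thesis .
qed

lemma measurable_failure_bound [measurable]:
  "(\<lambda>\<omega>. failure_bound (mixed_sample a b \<omega>) (mixed_sample c d \<omega>) j) \<in> borel_measurable (joint_law n \<sigma> f)"
  unfolding failure_bound_def by measurable

text \<open>Integration of \<open>error_bound\<close> term by term; the constants add up to
  \<open>12 + 6 * 27072 + 1188\<close>, below 200000.\<close>

lemma Z_hat_risk_le: "Z_hat_risk n \<sigma> f \<le> ennreal (200000 * \<rho>)"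
proof -
  interpret P: prob_space "joint_law n \<sigma> f" by (rule prob_space_joint_law)
  let ?r = "real n * \<rho>"
  have r: "0 < ?r" using n \<rho> by simp
  define a b c where "a = sqrt 2 / 2 * \<sigma>" and "b = sqrt 6 / 2 * \<sigma>" and "c = - (sqrt 2 * \<sigma>)"
  have var: "a\<^sup>2 + b\<^sup>2 = 2 * \<sigma>\<^sup>2" "a\<^sup>2 + (-b)\<^sup>2 = 2 * \<sigma>\<^sup>2" "c\<^sup>2 + 0\<^sup>2 = 2 * \<sigma>\<^sup>2"
    by (simp_all add: a_def b_def c_def power_mult_distrib power_divide)
  let ?F = "\<lambda>j \<omega>. 12 * m j * failure_bound (mixed_sample a b \<omega>) (mixed_sample a (-b) \<omega>) j"
  let ?p = "if ?r < 1 then 4 * ?r / H\<^sup>2 else 0"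
  let ?G = "\<lambda>\<omega>. point_energy (mixed_sample c 0 \<omega>)"
  have p: "0 \<le> ?p" using r by simp
  have bound: "real n * \<bar>Z_hat n \<sigma> (fst \<omega>) (fst (snd \<omega>)) (snd (snd \<omega>)) - Z\<bar>
    \<le> 12 * ?r + (\<Sum>j\<in>coarse_levels. ?F j \<omega>) + ?p * ?G \<omega>" for \<omega>
  proof -
    have "mixed_sample a b \<omega> = (\<lambda>i. fst \<omega> i + sqrt 2 / 2 * \<sigma> * fst (snd \<omega>) i + sqrt 6 / 2 * \<sigma> * snd (snd \<omega>) i)"
      "mixed_sample a (-b) \<omega> = (\<lambda>i. fst \<omega> i + sqrt 2 / 2 * \<sigma> * fst (snd \<omega>) i - sqrt 6 / 2 * \<sigma> * snd (snd \<omega>) i)"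
      "mixed_sample c 0 \<omega> = (\<lambda>i. fst \<omega> i - sqrt 2 * \<sigma> * fst (snd \<omega>) i)"
      by (simp_all add: mixed_sample_def a_def b_def c_def fun_eq_iff)
    then show ?thesis
      using error_bound[of "fst \<omega>" "fst (snd \<omega>)" "snd (snd \<omega>)"] by (auto split: if_splits)
  qed
  have "ennreal (real n) * Z_hat_risk n \<sigma> f
    \<le> (\<integral>\<^sup>+\<omega>. ennreal (12 * ?r) + (\<Sum>j\<in>coarse_levels. ennreal (?F j \<omega>)) + ennreal ?p * ennreal (?G \<omega>) \<partial>joint_law n \<sigma> f)"
  proof -
    \<comment> \<open>The factor \<open>1 / real n\<close> goes to the bounding side, where the
      integrand is known to be measurable and \<open>nn_integral_cmult\<close> applies;
      \<open>nn_integral_mono\<close> asks nothing of the estimator.\<close>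
    have "Z_hat_risk n \<sigma> f \<le> (\<integral>\<^sup>+\<omega>. ennreal (1 / real n) * (ennreal (12 * ?r)
        + (\<Sum>j\<in>coarse_levels. ennreal (?F j \<omega>)) + ennreal ?p * ennreal (?G \<omega>)) \<partial>joint_law n \<sigma> f)"
      unfolding Z_hat_risk_def joint_law_def[symmetric]
    proof (rule nn_integral_mono)
      fix \<omega>
      have S: "0 \<le> (\<Sum>j\<in>coarse_levels. ?F j \<omega>)" using failure_bound_nonneg by (intro sum_nonneg) simp
      have "\<bar>Z_hat n \<sigma> (fst \<omega>) (fst (snd \<omega>)) (snd (snd \<omega>)) - Z\<bar>
        \<le> 1 / real n * (12 * ?r + (\<Sum>j\<in>coarse_levels. ?F j \<omega>) + ?p * ?G \<omega>)"
        using bound[of \<omega>] n by (simp add: pos_le_divide_eq mult.commute)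
      then have "ennreal \<bar>Z_hat n \<sigma> (fst \<omega>) (fst (snd \<omega>)) (snd (snd \<omega>)) - Z\<bar>
        \<le> ennreal (1 / real n * (12 * ?r + (\<Sum>j\<in>coarse_levels. ?F j \<omega>) + ?p * ?G \<omega>))"
        by (rule ennreal_leI)
      also have "\<dots> = ennreal (1 / real n) * (ennreal (12 * ?r)
        + (\<Sum>j\<in>coarse_levels. ennreal (?F j \<omega>)) + ennreal ?p * ennreal (?G \<omega>))"
      proof -
        have 1: "(\<Sum>j\<in>coarse_levels. ennreal (?F j \<omega>)) = ennreal (\<Sum>j\<in>coarse_levels. ?F j \<omega>)"
          using failure_bound_nonneg by (intro sum_ennreal) simp
        have 2: "ennreal ?p * ennreal (?G \<omega>) = ennreal (?p * ?G \<omega>)"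
          using p by (rule ennreal_mult'[symmetric])
        have "0 \<le> ?p * ?G \<omega>" using p point_energy_nonneg by (rule mult_nonneg_nonneg)
        then show ?thesis
          unfolding 1 2 using r S
          by (subst ennreal_mult', simp, subst ennreal_plus[symmetric], simp, simp, subst ennreal_plus[symmetric]) auto
      qed
      finally show "(case \<omega> of (y, z1, z2) \<Rightarrow> ennreal \<bar>Z_hat n \<sigma> y z1 z2 - Z\<bar>)
        \<le> ennreal (1 / real n) * (ennreal (12 * ?r)
        + (\<Sum>j\<in>coarse_levels. ennreal (?F j \<omega>)) + ennreal ?p * ennreal (?G \<omega>))"
        by (simp add: case_prod_beta)
    qed
    also have "\<dots> = ennreal (1 / real n) * (\<integral>\<^sup>+\<omega>. ennreal (12 * ?r)
        + (\<Sum>j\<in>coarse_levels. ennreal (?F j \<omega>)) + ennreal ?p * ennreal (?G \<omega>) \<partial>joint_law n \<sigma> f)"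
      by (rule nn_integral_cmult) measurable
    finally have "ennreal (real n) * Z_hat_risk n \<sigma> f \<le> ennreal (real n) * (ennreal (1 / real n) * (\<integral>\<^sup>+\<omega>. ennreal (12 * ?r)
        + (\<Sum>j\<in>coarse_levels. ennreal (?F j \<omega>)) + ennreal ?p * ennreal (?G \<omega>) \<partial>joint_law n \<sigma> f))"
      by (rule mult_left_mono) simp
    moreover have "ennreal (real n) * ennreal (1 / real n) = 1"
      using n by (simp flip: ennreal_mult)
    ultimately show ?thesis by (simp add: mult.assoc[symmetric])
  qed
  also have "\<dots> = ennreal (12 * ?r) + (\<Sum>j\<in>coarse_levels. \<integral>\<^sup>+\<omega>. ennreal (?F j \<omega>) \<partial>joint_law n \<sigma> f)
    + ennreal ?p * (\<integral>\<^sup>+\<omega>. ennreal (?G \<omega>) \<partial>joint_law n \<sigma> f)"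
    by (simp add: nn_integral_add nn_integral_cmult nn_integral_sum P.emeasure_space_1)
  also have "\<dots> \<le> ennreal (12 * ?r) + (\<Sum>j\<in>coarse_levels. ennreal (27072 * ((2 * ?r + 1) * ?r\<^sup>2 / (m j)\<^sup>2)))
    + ennreal ?p * ennreal (99 * \<sigma>\<^sup>2)"
    by (intro add_mono sum_mono expected_failure_bound mult_left_mono nn_integral_point_energy var) auto
  also have "\<dots> = ennreal (12 * ?r) + ennreal (\<Sum>j\<in>coarse_levels. 27072 * ((2 * ?r + 1) * ?r\<^sup>2 / (m j)\<^sup>2))
    + ennreal (?p * (99 * \<sigma>\<^sup>2))"
    using r p by (subst sum_ennreal) (auto simp: ennreal_mult')
  also have "\<dots> = ennreal (12 * ?r + (\<Sum>j\<in>coarse_levels. 27072 * ((2 * ?r + 1) * ?r\<^sup>2 / (m j)\<^sup>2)) + ?p * (99 * \<sigma>\<^sup>2))"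
  proof -
    have "0 \<le> (\<Sum>j\<in>coarse_levels. 27072 * ((2 * ?r + 1) * ?r\<^sup>2 / (m j)\<^sup>2))"
      using r by (intro sum_nonneg) simp
    moreover have "0 \<le> ?p * (99 * \<sigma>\<^sup>2)" using p by (rule mult_nonneg_nonneg) simp
    ultimately show ?thesis using r by simp
  qed
  also have "\<dots> \<le> ennreal (200000 * ?r)"
  proof (rule ennreal_leI)
    have "(\<Sum>j\<in>coarse_levels. 27072 * ((2 * ?r + 1) * ?r\<^sup>2 / (m j)\<^sup>2)) \<le> 27072 * (6 * ?r)"
      using sum_coarse_levels by (simp only: sum_distrib_left[symmetric])
    \<comment> \<open>For \<open>?r < 1\<close>, \<open>noise_le\<close> gives
      \<open>\<sigma>\<^sup>2 \<le> 3 * H\<^sup>2\<close>, whence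
      \<open>1188 = 4 * 99 * 3\<close>.\<close>
    moreover have "?p * (99 * \<sigma>\<^sup>2) \<le> 1188 * ?r"
    proof (cases "?r < 1")
      case True
      have "\<sigma>\<^sup>2 / H\<^sup>2 \<le> 3"
      proof -
        have "(2 * real n * \<rho> + 1) * H\<^sup>2 \<le> 3 * H\<^sup>2" using True by (intro mult_right_mono) auto
        then have "\<sigma>\<^sup>2 \<le> 3 * H\<^sup>2" using noise_le by (rule order_trans[rotated])
        then show ?thesis using H by (simp add: pos_divide_le_eq)
      qed
      then have "396 * ?r * (\<sigma>\<^sup>2 / H\<^sup>2) \<le> 396 * ?r * 3" using r by (intro mult_left_mono) auto
      then show ?thesis using True by simp
    qed (use r in simp)
    ultimately show "12 * ?r + (\<Sum>j\<in>coarse_levels. 27072 * ((2 * ?r + 1) * ?r\<^sup>2 / (m j)\<^sup>2)) + ?p * (99 * \<sigma>\<^sup>2)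
      \<le> 200000 * ?r"
      using r by linarith
  qed
  finally have "ennreal (real n) * Z_hat_risk n \<sigma> f \<le> ennreal (real n) * ennreal (200000 * \<rho>)"
    by (simp add: mult.left_commute flip: ennreal_mult')
  then show ?thesis using n by (simp add: ennreal_mult_le_mult_iff)
qed

end

section \<open>Comparison of the risk with the benchmark\<close>

theorem theorem4p1:
  shows "\<exists>C1::real. C1 > 0 \<and>
           (\<forall>(n::nat) (\<sigma>::real) (f::real \<Rightarrow> real).
              n \<ge> 1 \<longrightarrow> \<sigma> > 0 \<longrightarrow> f \<in> convex_class \<longrightarrow>
                Z_hat_risk n \<sigma> f \<le> ennreal C1 * benchmark n \<sigma> f)"
proof (intro exI[of _ "600000 * exp (9 / 2)"] conjI allI impI)
  fix n :: nat and \<sigma> :: real and f :: "real \<Rightarrow> real"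
  assume "n \<ge> 1" "\<sigma> > 0" "f \<in> convex_class"
  then obtain H \<rho> where prof: "level_set_profile n \<sigma> f H \<rho>"
    and bench: "ennreal (exp (-9/2) / 3 * \<rho>) \<le> benchmark n \<sigma> f"
    by (rule exists_level_set_profile)
  have "Z_hat_risk n \<sigma> f \<le> ennreal (200000 * \<rho>)"
    using prof by (rule level_set_profile.Z_hat_risk_le)
  \<comment> \<open>The final constant is 200000 divided by the factor \<open>exp (-9/2) / 3\<close>
    of the lower bound.\<close>
  also have "200000 * \<rho> = 600000 * exp (9 / 2) * (exp (-9/2) / 3 * \<rho>)"
    by (simp add: mult_exp_exp field_simps flip: exp_add)
  also have "ennreal \<dots> = ennreal (600000 * exp (9 / 2)) * ennreal (exp (-9/2) / 3 * \<rho>)"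
    by (rule ennreal_mult') simp
  also have "\<dots> \<le> ennreal (600000 * exp (9 / 2)) * benchmark n \<sigma> f"
    using bench by (rule mult_left_mono) simp
  finally show "Z_hat_risk n \<sigma> f \<le> ennreal (600000 * exp (9 / 2)) * benchmark n \<sigma> f" .
qed simp

end
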